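(* Let $I\ni t\mapsto f(\cdot,t)\in\mathcal{O}_{\rm norm}(\overline{\mathbb{D}})$ be smooth on some time interval $I\subset[0,\infty)$ and assume that $f'\ne0$ on $\partial\mathbb{D}$ for all $t$ in this interval. Then for $q(t)\ge0$ the following are equivalent. (i) $f$ solves the Löwner-Kufarev equation $$\dot f(\zeta,t)=\zeta f'(\zeta,t)P(\zeta,t)\qquad(\zeta\in\mathbb{D}),\qquad P(\zeta,t)=\frac{1}{2\pi\mathrm{i}}\int_{\partial\mathbb{D}}\frac{q(t)}{|f'(z,t)|^2}\,\frac{z+\zeta}{z-\zeta}\,\frac{dz}{z}.$$ (ii) $f$ solves the Polubarinova-Galin equation $$\mathrm{Re}\big[\dot f(\zeta,t)\overline{\zeta f'(\zeta,t)}\big]=q(t)\quad\text{for }\zeta\in\partial\mathbb{D},$$ and $\dot f(\omega,t)=0$ for every root $\omega\in\mathbb{D}$ of $f'(\omega,t)=0$. (iii) $f$ solves the Polubarinova-Galin equation (as in (ii)) and $\{f(\cdot,t)\}$ is a subordination chain on $I$.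
   Context: $\mathbb{D}$ is the open unit disk. For a set $E\subset\mathbb{C}$ containing $0$, $\mathcal{O}_{\rm norm}(E)$ is the set of functions $f$ analytic in some neighborhood of $E$ with $f(0)=0$, $f'(0)>0$. Dot is $\partial/\partial t$, prime is $\partial/\partial\zeta$. "Smooth" means: locally in $t$ the functions $f(\cdot,t)$ are analytic in a common neighborhood of $\overline{\mathbb{D}}$ and depend smoothly on $t$ there. For $f,g\in\mathcal{O}_{\rm norm}(\mathbb{D})$, $f$ is subordinate to $g$, written $f\prec g$, if there is a univalent (injective analytic) function $\varphi:\mathbb{D}\to\mathbb{D}$, with $\varphi(0)=0$, $\varphi'(0)>0$, such that $f=g\circ\varphi$. A map $I\ni t\mapsto f(\cdot,t)\in\mathcal{O}_{\rm norm}(\mathbb{D})$ is a subordination chain on $I$ if $f(\cdot,s)\prec f(\cdot,t)$ whenever $s\le t$. *)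

theory Defs
  imports "HOL-Complex_Analysis.Complex_Analysis"
begin

(* f analytic_on E already means that f is holomorphic on some open superset of E. *)
definition O_norm :: "complex set \<Rightarrow> (complex \<Rightarrow> complex) set" where
  "O_norm E = {f. f analytic_on E \<and> f 0 = 0 \<and> deriv f 0 \<in> \<real> \<and> Re (deriv f 0) > 0}"

(* A family f(.,t) is represented as f :: real => complex => complex, with f t zeta = f(zeta,t).
   The time derivative is taken within I, hence one-sided at endpoints belonging to I. *)
definition time_deriv ::
    "real set \<Rightarrow> (real \<Rightarrow> complex \<Rightarrow> complex) \<Rightarrow> real \<Rightarrow> complex \<Rightarrow> complex" where
  "time_deriv I f t \<zeta> = vector_derivative (\<lambda>s. f s \<zeta>) (at t within I)"

(* Smooth dependence on t is C-infinity: all time derivatives exist and are jointly continuous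
   in (t, zeta).  As each f t is holomorphic, Cauchy's formula then gives joint continuity of
   all mixed derivatives. *)
definition smooth_family :: "real set \<Rightarrow> (real \<Rightarrow> complex \<Rightarrow> complex) \<Rightarrow> bool" where
  "smooth_family I f \<longleftrightarrow>
    (\<forall>t0\<in>I. \<exists>e>0. \<exists>U. open U \<and> cball 0 1 \<subseteq> U \<and>
       (\<forall>t\<in>I \<inter> ball t0 e. f t holomorphic_on U) \<and>
       (\<forall>k. (\<forall>t\<in>I \<inter> ball t0 e. \<forall>\<zeta>\<in>U.
               (\<lambda>s. (time_deriv I ^^ k) f s \<zeta>) differentiable (at t within I)) \<and>
            continuous_on ((I \<inter> ball t0 e) \<times> U) (\<lambda>(t, \<zeta>). (time_deriv I ^^ k) f t \<zeta>)))"

definition subordinate :: "(complex \<Rightarrow> complex) \<Rightarrow> (complex \<Rightarrow> complex) \<Rightarrow> bool" where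
  "subordinate f g \<longleftrightarrow>
    (\<exists>\<phi>. \<phi> holomorphic_on ball 0 1 \<and> inj_on \<phi> (ball 0 1) \<and> \<phi> ` ball 0 1 \<subseteq> ball 0 1 \<and>
         \<phi> 0 = 0 \<and> deriv \<phi> 0 \<in> \<real> \<and> Re (deriv \<phi> 0) > 0 \<and>
         (\<forall>z\<in>ball 0 1. f z = g (\<phi> z)))"

definition subordination_chain :: "real set \<Rightarrow> (real \<Rightarrow> complex \<Rightarrow> complex) \<Rightarrow> bool" where
  "subordination_chain I f \<longleftrightarrow>
    (\<forall>t\<in>I. f t \<in> O_norm (ball 0 1)) \<and>
    (\<forall>s\<in>I. \<forall>t\<in>I. s \<le> t \<longrightarrow> subordinate (f s) (f t))"

definition LK_P :: "(real \<Rightarrow> real) \<Rightarrow> (real \<Rightarrow> complex \<Rightarrow> complex) \<Rightarrow> real \<Rightarrow> complex \<Rightarrow> complex" where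
  "LK_P q f t \<zeta> =
    1 / (2 * of_real pi * \<i>) *
    contour_integral (circlepath 0 1)
      (\<lambda>z. of_real (q t / (cmod (deriv (f t) z))\<^sup>2) * ((z + \<zeta>) / (z - \<zeta>)) / z)"

definition Loewner_Kufarev ::
    "real set \<Rightarrow> (real \<Rightarrow> real) \<Rightarrow> (real \<Rightarrow> complex \<Rightarrow> complex) \<Rightarrow> bool" where
  "Loewner_Kufarev I q f \<longleftrightarrow>
    (\<forall>t\<in>I. \<forall>\<zeta>\<in>ball 0 1. time_deriv I f t \<zeta> = \<zeta> * deriv (f t) \<zeta> * LK_P q f t \<zeta>)"

definition Polubarinova_Galin ::
    "real set \<Rightarrow> (real \<Rightarrow> real) \<Rightarrow> (real \<Rightarrow> complex \<Rightarrow> complex) \<Rightarrow> bool" where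
  "Polubarinova_Galin I q f \<longleftrightarrow>
    (\<forall>t\<in>I. \<forall>\<zeta>\<in>sphere 0 1. Re (time_deriv I f t \<zeta> * cnj (\<zeta> * deriv (f t) \<zeta>)) = q t)"

end

theory Submission
  imports Defs
begin

text \<open>All three statements amount to holomorphy of \<open>p = \<partial>\<^sub>t f / (\<zeta> f')\<close> in the disc. The Polubarinova-Galin
  equation says that \<open>Re p = q / |f'|\<^sup>2\<close> on the circle, so once \<open>p\<close> is holomorphic the Schwarz
  integral formula identifies it with \<open>P\<close>; conversely the boundary values of \<open>Re P\<close> are those of its
  Poisson integral.

  Condition (ii) only asks for \<open>\<partial>\<^sub>t f\<close> to vanish once at a critical point, which does not rule out a pole
  of \<open>p\<close> at a multiple critical point at a single time. As the condition holds for all times, a pole whose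
  critical point has minimal order \<open>m\<close> would persist with order \<open>m\<close> for nearby times,
  and differentiating \<open>f\<^bsup>(k)\<^esup>(\<omega>(t), t) = 0\<close>, \<open>1 \<le> k < m\<close>, along it shows that there is no pole.

  (i) implies (iii) by solving the characteristic equation \<open>w' = - w P(w, t)\<close>, along which \<open>f\<close> is constant.
  For (iii) implies (ii), a quantitative Schwarz lemma bounds the distance of the subordinating map from
  the identity by \<open>O(t - s)\<close>, so that critical points can only move at bounded speed.\<close>

subsection \<open>Means over circles\<close>

text \<open>The equation on the circle fixes only Re p there, and functions with poles in the disc
  and vanishing real part on the circle are invisible to it. Every further condition serves to
  exclude such poles. At the origin this is the work of the normalisation: differentiating f(0,t) =
  0 and f'(0,t) > 0 in time removes the pole of p at 0 and also the imaginary constant that real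
  boundary data leave undetermined. The interval may contain endpoints, where time derivatives are
  one-sided, and multiple critical points may split, so that they need not form smooth curves. Both
  difficulties are met by working with sequences of times tending to \<open>t0\<close> and points
  chosen on level sets, instead of with an implicit function theorem. Operations in \<zeta> are
  written as means over circles with explicit kernels; continuity and differentiation in t then pass
  through a single integral and commute with \<open>deriv\<close>. The sign of q enters as Re P
  \<ge> 0, which keeps the characteristics inside the disc.\<close>

definition circle_mean :: "complex \<Rightarrow> real \<Rightarrow> (complex \<Rightarrow> 'a::euclidean_space) \<Rightarrow> 'a" where
  "circle_mean z r F = integral {0..1} (\<lambda>x. F (circlepath z r x))"

lemma circlepath_in_sphere [simp]: "r \<ge> 0 \<Longrightarrow> circlepath z r x \<in> sphere z r"
  by (simp add: circlepath dist_norm norm_mult)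

lemma continuous_on_circlepath [continuous_intros]:
  "continuous_on S g \<Longrightarrow> continuous_on S (\<lambda>y. circlepath z r (g y))"
  by (auto simp: circlepath intro!: continuous_intros)

lemma continuous_on_circle:
  assumes "continuous_on (sphere z r) F" "r \<ge> 0"
  shows "continuous_on S (\<lambda>x. F (circlepath z r x))"
  by (rule continuous_on_compose2[OF assms(1)]) (use assms in \<open>auto intro!: continuous_intros simp del: mem_sphere\<close>)

lemma circle_mean_cong:
  assumes "\<And>u. u \<in> sphere z r \<Longrightarrow> F u = G u" "r \<ge> 0"
  shows "circle_mean z r F = circle_mean z r G"
  unfolding circle_mean_def using assms by (intro integral_cong) (auto simp del: mem_sphere)

lemma integrable_on_circle:
  fixes F :: "complex \<Rightarrow> 'a::euclidean_space"
  assumes "continuous_on (sphere z r) F" "r \<ge> 0"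
  shows "(\<lambda>x. F (circlepath z r x)) integrable_on {0..1}"
  by (intro integrable_continuous_real continuous_on_circle assms)

lemma circle_mean_const [simp]: "circle_mean z r (\<lambda>_. c) = c"
  by (simp add: circle_mean_def)

lemma circle_mean_add:
  assumes "continuous_on (sphere z r) F" "continuous_on (sphere z r) G" "r \<ge> 0"
  shows "circle_mean z r (\<lambda>u. F u + G u) = circle_mean z r F + circle_mean z r G"
  unfolding circle_mean_def by (intro integral_add integrable_on_circle assms)

lemma circle_mean_diff:
  assumes "continuous_on (sphere z r) F" "continuous_on (sphere z r) G" "r \<ge> 0"
  shows "circle_mean z r (\<lambda>u. F u - G u) = circle_mean z r F - circle_mean z r G"
  unfolding circle_mean_def by (intro integral_diff integrable_on_circle assms)

lemma circle_mean_mult_left: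
  fixes c :: "'a::{euclidean_space,real_normed_field}"
  shows "circle_mean z r (\<lambda>u. c * F u) = c * circle_mean z r F"
  unfolding circle_mean_def by simp

lemma circle_mean_bounded_linear:
  assumes "bounded_linear h" "continuous_on (sphere z r) F" "r \<ge> 0"
  shows "circle_mean z r (\<lambda>u. h (F u)) = h (circle_mean z r F)"
  using integral_linear[OF integrable_on_circle[OF assms(2,3)] assms(1)]
  by (simp add: circle_mean_def o_def)

lemma circle_mean_mono:
  fixes F :: "complex \<Rightarrow> real"
  assumes "continuous_on (sphere z r) F" "continuous_on (sphere z r) G" "r \<ge> 0"
    "\<And>u. u \<in> sphere z r \<Longrightarrow> F u \<le> G u"
  shows "circle_mean z r F \<le> circle_mean z r G"
  unfolding circle_mean_def
  by (intro integral_le integrable_on_circle assms) (auto simp: assms simp del: mem_sphere)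

lemma norm_circle_mean_le:
  fixes F :: "complex \<Rightarrow> 'a::euclidean_space"
  assumes "continuous_on (sphere z r) F" "continuous_on (sphere z r) G" "r \<ge> 0"
    "\<And>u. u \<in> sphere z r \<Longrightarrow> norm (F u) \<le> G u"
  shows "norm (circle_mean z r F) \<le> circle_mean z r G"
  unfolding circle_mean_def
  by (intro integral_norm_bound_integral integrable_on_circle assms) (auto simp: assms simp del: mem_sphere)

text \<open>The parameter space is left arbitrary so that it can be a product of times and points;
  joint continuity in both then comes from this one statement.\<close>

lemma continuous_on_circle_mean:
  fixes G :: "'b::topological_space \<Rightarrow> complex \<Rightarrow> 'a::euclidean_space"
  assumes "continuous_on (T \<times> sphere z r) (\<lambda>(t, u). G t u)" "r \<ge> 0"
  shows "continuous_on T (\<lambda>t. circle_mean z r (G t))"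
proof -
  have "continuous_on (T \<times> cbox 0 (1::real)) (\<lambda>(t, x). G t (circlepath z r x))"
    unfolding split_beta
    by (rule continuous_on_compose2[OF assms(1), where f = "\<lambda>p. (fst p, circlepath z r (snd p))", simplified split_beta fst_conv snd_conv])
      (use assms(2) in \<open>auto intro!: continuous_intros simp del: mem_sphere\<close>)
  from integral_continuous_on_param[OF this] show ?thesis
    by (simp add: circle_mean_def)
qed

text \<open>The velocity of \<open>circlepath z r\<close> at its point u is 2 pi i (u - z), which
  accounts for the factor \<open>u - z\<close> inside the mean.\<close>

lemma has_contour_integral_circle_mean:
  assumes "continuous_on (sphere z r) f" "r > 0"
  shows "(f has_contour_integral 2 * of_real pi * \<i> * circle_mean z r (\<lambda>u. f u * (u - z))) (circlepath z r)"
proof -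
  have "continuous_on (sphere z r) (\<lambda>u. f u * (u - z))"
    by (intro continuous_intros assms)
  from integrable_on_circle[OF this] assms(2)
  have "((\<lambda>x. f (circlepath z r x) * (circlepath z r x - z)) has_integral circle_mean z r (\<lambda>u. f u * (u - z))) {0..1}"
    by (auto simp: circle_mean_def)
  from has_integral_mult_right[OF this, of "2 * of_real pi * \<i>"]
  show ?thesis unfolding has_contour_integral_def
    by (rule has_integral_eq[rotated]) (simp add: vector_derivative_circlepath01, simp add: circlepath mult_ac)
qed

lemma contour_integral_circle_mean:
  assumes "continuous_on (sphere z r) f" "r > 0"
  shows "contour_integral (circlepath z r) f = 2 * of_real pi * \<i> * circle_mean z r (\<lambda>u. f u * (u - z))"
  by (rule contour_integral_unique[OF has_contour_integral_circle_mean[OF assms]])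

lemma Cauchy_circle_mean:
  assumes "continuous_on (cball z r) f" "f holomorphic_on ball z r" "w \<in> ball z r"
  shows "circle_mean z r (\<lambda>u. f u * (u - z) / (u - w)) = f w"
proof -
  have r: "r > 0" using assms(3) by (metis ball_eq_empty empty_iff not_le)
  have "continuous_on (sphere z r) (\<lambda>u. f u / (u - w))"
    using assms(3) by (intro continuous_intros continuous_on_subset[OF assms(1)]) auto
  moreover have "norm (w - z) < r" using assms(3) by (simp add: dist_norm norm_minus_commute)
  ultimately have "2 * of_real pi * \<i> * circle_mean z r (\<lambda>u. f u / (u - w) * (u - z)) = 2 * of_real pi * \<i> * f w"
    by (intro has_contour_integral_unique[OF has_contour_integral_circle_mean[OF _ r]
          Cauchy_integral_circlepath[OF assms(1,2)]])
  thus ?thesis by simp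
qed

lemma circle_mean_value:
  assumes "continuous_on (cball z r) f" "f holomorphic_on ball z r" "r > 0"
  shows "circle_mean z r f = f z"
proof -
  have "circle_mean z r f = circle_mean z r (\<lambda>u. f u * (u - z) / (u - z))"
    using assms by (intro circle_mean_cong) auto
  thus ?thesis using Cauchy_circle_mean[OF assms(1,2), of z] assms(3) by simp
qed

lemma deriv_circle_mean:
  assumes "continuous_on (cball z r) f" "f holomorphic_on ball z r" "r > 0"
  shows "circle_mean z r (\<lambda>u. f u / (u - z)) = deriv f z"
proof -
  have c: "continuous_on (sphere z r) (\<lambda>u. f u / (u - z)^2)"
    using assms(3) by (intro continuous_intros continuous_on_subset[OF assms(1)]) auto
  have "2 * of_real pi * \<i> * circle_mean z r (\<lambda>u. f u / (u - z)^2 * (u - z)) = 2 * of_real pi * \<i> * deriv f z"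
    using contour_integral_circle_mean[OF c assms(3)]
      Cauchy_contour_integral_circlepath_2[OF assms(1,2), of z] assms(3) by simp
  hence "circle_mean z r (\<lambda>u. f u / (u - z)^2 * (u - z)) = deriv f z" by simp
  moreover have "circle_mean z r (\<lambda>u. f u / (u - z)^2 * (u - z)) = circle_mean z r (\<lambda>u. f u / (u - z))"
    using assms(3) by (intro circle_mean_cong) (auto simp: power2_eq_square)
  ultimately show ?thesis by simp
qed

text \<open>A Cauchy integral is holomorphic for any continuous density, whether or not the density
  extends into the disc. This makes limits and time derivatives of holomorphic functions holomorphic
  again.\<close>

lemma holomorphic_on_Cauchy_mean:
  assumes "continuous_on (sphere z r) g"
  shows "(\<lambda>w. circle_mean z r (\<lambda>u. g u * (u - z) / (u - w))) holomorphic_on ball z r"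
proof (cases "r > 0")
  case True
  define G where "G = (\<lambda>w. 2 * of_real pi * \<i> * circle_mean z r (\<lambda>u. g u * (u - z) / (u - w)))"
  \<comment> \<open>The exponent 1 matches the form of
    \<open>Cauchy_next_derivative_circlepath\<close>, whose kernel is a power of 1 / (u -
    w).\<close>
  have 1: "((\<lambda>u. g u / (u - w) ^ 1) has_contour_integral G w) (circlepath z r)" if "w \<in> ball z r" for w
  proof -
    have "continuous_on (sphere z r) (\<lambda>u. g u / (u - w) ^ 1)"
      using that by (intro continuous_intros assms) auto
    from has_contour_integral_circle_mean[OF this True] show ?thesis by (simp add: G_def)
  qed
  have 2: "continuous_on (path_image (circlepath z r)) g"
    using True assms by simp
  have "G holomorphic_on ball z r"
    unfolding holomorphic_on_open[OF open_ball]
    using Cauchy_next_derivative_circlepath(2)[OF 2 1] by blast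
  hence "(\<lambda>w. G w / (2 * of_real pi * \<i>)) holomorphic_on ball z r"
    by (intro holomorphic_intros) auto
  thus ?thesis by (simp add: G_def)
qed (simp add: ball_empty holomorphic_on_def)

subsection \<open>The Herglotz kernel and the Schwarz formula\<close>

text \<open>The kernel of \<open>LK_P\<close> without its factor 1 / z, which the mean over the unit
  circle absorbs. Its real part is the Poisson kernel.\<close>

definition herglotz :: "complex \<Rightarrow> complex \<Rightarrow> complex" where
  "herglotz w u = (u + w) / (u - w)"

lemma Re_herglotz:
  assumes "cmod u = 1" "u \<noteq> w"
  shows "Re (herglotz w u) = (1 - (cmod w)\<^sup>2) / (cmod (u - w))\<^sup>2"
proof -
  have "(cmod u)\<^sup>2 = 1" using assms by simp
  thus ?thesis
    by (simp add: herglotz_def Re_divide cmod_power2) (simp add: power2_eq_square algebra_simps)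
qed

lemma Re_herglotz_pos:
  assumes "cmod u = 1" "cmod w < 1"
  shows "Re (herglotz w u) > 0"
proof -
  have "(cmod w)\<^sup>2 < 1" using assms by (simp add: power_less_one_iff)
  moreover have "u \<noteq> w" using assms by auto
  ultimately show ?thesis using assms by (subst Re_herglotz) auto
qed

lemma continuous_on_herglotz:
  assumes "cmod w < 1"
  shows "continuous_on (sphere 0 1) (herglotz w)"
  unfolding herglotz_def using assms by (intro continuous_intros) auto

text \<open>On the circle the kernel is 2 u / (u - w) - 1, so the mean is twice Cauchy's formula
  minus the mean value property.\<close>

lemma circle_mean_herglotz:
  assumes "continuous_on (cball 0 1) p" "p holomorphic_on ball 0 1" "cmod w < 1"
  shows "circle_mean 0 1 (\<lambda>u. p u * herglotz w u) = 2 * p w - p 0"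
proof -
  have cs: "continuous_on (sphere 0 1) p"
    by (rule continuous_on_subset[OF assms(1)]) auto
  have "circle_mean 0 1 (\<lambda>u. p u * herglotz w u) = circle_mean 0 1 (\<lambda>u. 2 * (p u * (u - 0) / (u - w)) - p u)"
    using assms(3) by (intro circle_mean_cong) (auto simp: herglotz_def divide_simps algebra_simps)
  also have "\<dots> = circle_mean 0 1 (\<lambda>u. 2 * (p u * (u - 0) / (u - w))) - circle_mean 0 1 p"
    using assms(3) by (intro circle_mean_diff continuous_intros cs) auto
  also have "circle_mean 0 1 (\<lambda>u. 2 * (p u * (u - 0) / (u - w))) = 2 * circle_mean 0 1 (\<lambda>u. (p u * (u - 0) / (u - w)))"
    by (rule circle_mean_mult_left)
  also have "circle_mean 0 1 (\<lambda>u. (p u * (u - 0) / (u - w))) = p w"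
    using assms by (intro Cauchy_circle_mean) auto
  also have "circle_mean 0 1 p = p 0"
    using assms by (intro circle_mean_value) auto
  finally show ?thesis .
qed

text \<open>On the circle \<open>cnj u\<close> is 1 / u, which turns the kernel into the conjugate
  of (1 + \<open>cnj w\<close> u) / (1 - \<open>cnj w\<close> u). This is holomorphic in the disc
  with value 1 at 0, so only the mean value property remains.\<close>

lemma circle_mean_cnj_herglotz:
  assumes "continuous_on (cball 0 1) p" "p holomorphic_on ball 0 1" "cmod w < 1"
  shows "circle_mean 0 1 (\<lambda>u. cnj (p u) * herglotz w u) = cnj (p 0)"
proof -
  have ne: "1 - cnj w * u \<noteq> 0" if "cmod u \<le> 1" for u
  proof
    assume "1 - cnj w * u = 0"
    hence "cmod (cnj w * u) = 1" by simp
    moreover have "cmod (cnj w * u) \<le> cmod w"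
      using that mult_left_mono[of "cmod u" 1 "cmod w"] by (simp add: norm_mult)
    ultimately show False using assms(3) by simp
  qed
  define P where "P = (\<lambda>u. p u * ((1 + cnj w * u) / (1 - cnj w * u)))"
  have cP: "continuous_on (cball 0 1) P" unfolding P_def
    using ne by (intro continuous_intros assms) auto
  have hP: "P holomorphic_on ball 0 1" unfolding P_def
    using ne by (intro holomorphic_intros assms) auto
  have "circle_mean 0 1 (\<lambda>u. cnj (p u) * herglotz w u) = circle_mean 0 1 (\<lambda>u. cnj (P u))"
  proof (intro circle_mean_cong)
    fix u :: complex assume "u \<in> sphere 0 1"
    hence u: "cmod u = 1" by simp
    hence uu: "cnj u * u = 1"
      by (metis complex_norm_square mult.commute of_real_1 power_one)
    have "u \<noteq> w" "1 - w * cnj u \<noteq> 0" using ne[of u] u assms(3) by (auto dest: arg_cong[of _ _ cnj])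
    moreover have "1 + w * cnj u = cnj u * (u + w)" "1 - w * cnj u = cnj u * (u - w)"
      using uu by (simp_all add: algebra_simps)
    ultimately have "herglotz w u = (1 + w * cnj u) / (1 - w * cnj u)"
      unfolding herglotz_def by simp
    thus "cnj (p u) * herglotz w u = cnj (P u)" by (simp add: P_def)
  qed auto
  also have "\<dots> = cnj (circle_mean 0 1 P)"
    by (intro circle_mean_bounded_linear bounded_linear_cnj continuous_on_subset[OF cP]) auto
  also have "circle_mean 0 1 P = p 0"
    using circle_mean_value[OF cP hP] by (simp add: P_def)
  finally show ?thesis .
qed

text \<open>Half the sum of the two preceding means, since Re p is half of p plus its conjugate. The
  constant Im (p 0) cannot be seen from Re p and has to be determined separately.\<close>

theorem Schwarz_integral_formula:
  assumes "continuous_on (cball 0 1) p" "p holomorphic_on ball 0 1" "cmod w < 1"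
  shows "circle_mean 0 1 (\<lambda>u. of_real (Re (p u)) * herglotz w u) = p w - \<i> * of_real (Im (p 0))"
proof -
  have cs: "continuous_on (sphere 0 1) p"
    by (rule continuous_on_subset[OF assms(1)]) auto
  have "circle_mean 0 1 (\<lambda>u. of_real (Re (p u)) * herglotz w u) =
    circle_mean 0 1 (\<lambda>u. (1/2) * (p u * herglotz w u + cnj (p u) * herglotz w u))"
    by (intro circle_mean_cong) (simp_all add: complex_add_cnj flip: distrib_right)
  also have "\<dots> = (1/2) * circle_mean 0 1 (\<lambda>u. p u * herglotz w u + cnj (p u) * herglotz w u)"
    by (rule circle_mean_mult_left)
  also have "circle_mean 0 1 (\<lambda>u. p u * herglotz w u + cnj (p u) * herglotz w u) =
     circle_mean 0 1 (\<lambda>u. p u * herglotz w u) + circle_mean 0 1 (\<lambda>u. cnj (p u) * herglotz w u)"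
    by (intro circle_mean_add continuous_intros continuous_on_herglotz assms cs) auto
  also have "\<dots> = 2 * p w - p 0 + cnj (p 0)"
    using circle_mean_herglotz[OF assms] circle_mean_cnj_herglotz[OF assms] by simp
  also have "1 / 2 * (2 * p w - p 0 + cnj (p 0)) = p w - \<i> * of_real (Im (p 0))"
    by (simp add: complex_eq_iff)
  finally show ?thesis .
qed

section \<open>Poisson integrals and their boundary values\<close>

lemma circle_mean_Poisson_kernel:
  assumes "cmod w < 1"
  shows "circle_mean 0 1 (\<lambda>u. Re (herglotz w u)) = 1"
proof -
  have "circle_mean 0 1 (\<lambda>u. Re (herglotz w u)) = Re (circle_mean 0 1 (herglotz w))"
    using assms by (intro circle_mean_bounded_linear bounded_linear_Re continuous_on_herglotz) auto
  also have "circle_mean 0 1 (herglotz w) = 1"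
    using circle_mean_herglotz[of "\<lambda>_. 1" w] assms by simp
  finally show ?thesis by simp
qed

text \<open>The holomorphic function in the disc whose real part is the Poisson integral of
  \<open>Q\<close> and whose value at 0 is real, namely the mean of \<open>Q\<close>.\<close>

definition schwarz :: "(complex \<Rightarrow> real) \<Rightarrow> complex \<Rightarrow> complex" where
  "schwarz Q w = circle_mean 0 1 (\<lambda>u. of_real (Q u) * herglotz w u)"

lemma Re_schwarz:
  assumes "continuous_on (sphere 0 1) Q" "cmod w < 1"
  shows "Re (schwarz Q w) = circle_mean 0 1 (\<lambda>u. Q u * Re (herglotz w u))"
proof -
  have "circle_mean 0 1 (\<lambda>u. Re (of_real (Q u) * herglotz w u)) = Re (schwarz Q w)"
    unfolding schwarz_def using assms
    by (intro circle_mean_bounded_linear bounded_linear_Re continuous_intros continuous_on_herglotz) auto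
  thus ?thesis by simp
qed

lemma Re_schwarz_nonneg:
  assumes "continuous_on (sphere 0 1) Q" "cmod w < 1" "\<And>u. u \<in> sphere 0 1 \<Longrightarrow> Q u \<ge> 0"
  shows "Re (schwarz Q w) \<ge> 0"
proof -
  have "circle_mean 0 1 (\<lambda>_. 0::real) \<le> circle_mean 0 1 (\<lambda>u. Q u * Re (herglotz w u))"
    using assms by (intro circle_mean_mono continuous_intros continuous_on_herglotz mult_nonneg_nonneg)
      (auto intro: Re_herglotz_pos less_imp_le)
  thus ?thesis using assms by (simp add: Re_schwarz)
qed

lemma holomorphic_schwarz:
  assumes "continuous_on (sphere 0 1) Q"
  shows "schwarz Q holomorphic_on ball 0 1"
proof -
  have cQ: "continuous_on (sphere 0 1) (\<lambda>u. complex_of_real (Q u))"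
    using assms by (intro continuous_intros)
  have "schwarz Q w = 2 * circle_mean 0 1 (\<lambda>u. of_real (Q u) * (u - 0) / (u - w)) - circle_mean 0 1 (\<lambda>u. of_real (Q u))"
    if "w \<in> ball 0 1" for w
  proof -
    have "schwarz Q w = circle_mean 0 1 (\<lambda>u. 2 * (of_real (Q u) * (u - 0) / (u - w)) - of_real (Q u))"
      unfolding schwarz_def using that
      by (intro circle_mean_cong) (auto simp: herglotz_def divide_simps algebra_simps)
    also have "\<dots> = circle_mean 0 1 (\<lambda>u. 2 * (of_real (Q u) * (u - 0) / (u - w))) - circle_mean 0 1 (\<lambda>u. of_real (Q u))"
      using that by (intro circle_mean_diff continuous_intros assms) auto
    also have "circle_mean 0 1 (\<lambda>u. 2 * (of_real (Q u) * (u - 0) / (u - w))) = 2 * circle_mean 0 1 (\<lambda>u. of_real (Q u) * (u - 0) / (u - w))"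
      by (rule circle_mean_mult_left)
    finally show ?thesis .
  qed
  moreover have "(\<lambda>w. 2 * circle_mean 0 1 (\<lambda>u. of_real (Q u) * (u - 0) / (u - w)) - circle_mean 0 1 (\<lambda>u. of_real (Q u))) holomorphic_on ball 0 1"
    by (intro holomorphic_intros holomorphic_on_Cauchy_mean cQ)
  ultimately show ?thesis using holomorphic_transform by fastforce
qed

text \<open>The Poisson kernel is a positive approximate identity: it has mean one and, as w tends
  to \<open>z0\<close>, is small away from \<open>z0\<close>. Radial approach is enough for the
  application, where all other quantities are continuous across the circle.\<close>

theorem Re_schwarz_radial_limit:
  assumes cQ: "continuous_on (sphere 0 1) Q" and z0: "cmod z0 = 1"
  shows "((\<lambda>r. Re (schwarz Q (of_real r * z0))) \<longlongrightarrow> Q z0) (at_left 1)"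
proof (rule tendstoI)
  fix e :: real assume "e > 0"
  obtain d where d: "d > 0" "\<And>u. u \<in> sphere 0 1 \<Longrightarrow> dist u z0 < d \<Longrightarrow> dist (Q u) (Q z0) < e / 2"
    using cQ z0 \<open>e > 0\<close> unfolding continuous_on_iff by (metis half_gt_zero mem_sphere_0)
  have "compact (Q ` sphere 0 1)" by (intro compact_continuous_image cQ) auto
  then obtain M where "\<forall>x\<in>Q ` sphere 0 1. norm x \<le> M"
    using compact_imp_bounded[of "Q ` sphere 0 1"] unfolding bounded_iff by blast
  hence M: "\<bar>Q u\<bar> \<le> M" if "u \<in> sphere 0 1" for u
    using that by auto
  have M0: "M \<ge> 0" using M[of z0] z0 by force
  have "((\<lambda>r. e / 2 + 2 * M * ((1 - r\<^sup>2) / (d / 2)\<^sup>2)) \<longlongrightarrow> e / 2 + 2 * M * ((1 - 1\<^sup>2) / (d / 2)\<^sup>2)) (at_left 1)"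
    using d(1) by (intro tendsto_intros) auto
  hence "\<forall>\<^sub>F r in at_left 1. e / 2 + 2 * M * ((1 - r\<^sup>2) / (d / 2)\<^sup>2) < e"
    by (rule order_tendstoD(2)) (use \<open>e > 0\<close> in simp)
  \<comment> \<open>With 1 - r < d / 2, a point of the circle at distance at least d from
    \<open>z0\<close> is still at distance at least d / 2 from w.\<close>
  moreover have "\<forall>\<^sub>F r in at_left (1::real). max 0 (1 - d / 2) < r \<and> r < 1"
    using d(1) by (auto simp: eventually_at_left_field intro!: exI[of _ "max 0 (1 - d / 2)"])
  ultimately show "\<forall>\<^sub>F r in at_left 1. dist (Re (schwarz Q (of_real r * z0))) (Q z0) < e"
  proof eventually_elim
    case (elim r)
    define w where "w = of_real r * z0"
    have w: "cmod w = r" using elim z0 by (simp add: w_def norm_mult)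
    have w1: "cmod w < 1" using w elim by simp
    let ?K = "\<lambda>u. Re (herglotz w u)"
    have cK: "continuous_on (sphere 0 1) ?K"
      by (intro continuous_intros continuous_on_herglotz w1)
    have "Re (schwarz Q w) - Q z0 = circle_mean 0 1 (\<lambda>u. Q u * ?K u) - Q z0 * circle_mean 0 1 ?K"
      using Re_schwarz[OF cQ w1] circle_mean_Poisson_kernel[OF w1] by simp
    also have "\<dots> = circle_mean 0 1 (\<lambda>u. Q u * ?K u - Q z0 * ?K u)"
      by (subst circle_mean_diff, intro continuous_intros cQ cK, intro continuous_intros cQ cK, simp)
         (subst circle_mean_mult_left, rule refl)
    finally have eq: "Re (schwarz Q w) - Q z0 = circle_mean 0 1 (\<lambda>u. Q u * ?K u - Q z0 * ?K u)" .
    have "norm (circle_mean 0 1 (\<lambda>u. Q u * ?K u - Q z0 * ?K u)) \<le>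
      circle_mean 0 1 (\<lambda>u. e / 2 * ?K u + 2 * M * ((1 - r\<^sup>2) / (d / 2)\<^sup>2))"
    proof (intro norm_circle_mean_le continuous_intros cQ cK)
      fix u :: complex assume u: "u \<in> sphere 0 1"
      have u1: "cmod u = 1" using u by simp
      have K0: "?K u > 0" by (intro Re_herglotz_pos u1 w1)
      have eq: "norm (Q u * ?K u - Q z0 * ?K u) = \<bar>Q u - Q z0\<bar> * ?K u"
        using K0 by (simp add: abs_mult flip: left_diff_distrib)
      have r2: "r\<^sup>2 \<le> 1" using elim by (simp add: abs_square_le_1)
      show "norm (Q u * ?K u - Q z0 * ?K u) \<le> e / 2 * ?K u + 2 * M * ((1 - r\<^sup>2) / (d / 2)\<^sup>2)"
      proof (cases "dist u z0 < d")
        case True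
        hence "\<bar>Q u - Q z0\<bar> \<le> e / 2" using d(2)[OF u] by (simp add: dist_real_def)
        hence "\<bar>Q u - Q z0\<bar> * ?K u \<le> e / 2 * ?K u" using K0 by (intro mult_right_mono) auto
        moreover have "0 \<le> 2 * M * ((1 - r\<^sup>2) / (d / 2)\<^sup>2)" using M0 r2 by auto
        ultimately show ?thesis unfolding eq by linarith
      next
        case False
        have "dist u z0 \<le> cmod (u - w) + cmod (w - z0)"
          using norm_triangle_ineq[of "u - w" "w - z0"] by (simp add: dist_norm)
        also have "w - z0 = of_real (r - 1) * z0" by (simp add: w_def algebra_simps)
        also have "cmod \<dots> = 1 - r" using elim z0 by (simp add: norm_mult flip: of_real_diff)
        finally have "d / 2 \<le> cmod (u - w)" using False elim by (simp add: max_def split: if_splits)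
        hence "(d / 2)\<^sup>2 \<le> (cmod (u - w))\<^sup>2" using d(1) by (intro power_mono) auto
        moreover have "u \<noteq> w" using u1 w1 by auto
        ultimately have K: "?K u \<le> (1 - r\<^sup>2) / (d / 2)\<^sup>2"
          using d(1) r2 by (subst Re_herglotz[OF u1]) (auto simp: w intro!: divide_left_mono)
        have "\<bar>Q u - Q z0\<bar> \<le> 2 * M" using M[OF u] M[of z0] z0 by force
        hence "\<bar>Q u - Q z0\<bar> * ?K u \<le> 2 * M * ((1 - r\<^sup>2) / (d / 2)\<^sup>2)"
          using K K0 M0 by (intro mult_mono) auto
        moreover have "0 \<le> e / 2 * ?K u" using K0 \<open>e > 0\<close> by simp
        ultimately show ?thesis unfolding eq by linarith
      qed
    qed (auto intro: continuous_on_herglotz w1)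
    also have "\<dots> = e / 2 + 2 * M * ((1 - r\<^sup>2) / (d / 2)\<^sup>2)"
    proof -
      have "continuous_on (sphere 0 1) (\<lambda>u. e / 2 * ?K u)" by (intro continuous_intros continuous_on_herglotz w1)
      from circle_mean_add[OF this continuous_on_const] circle_mean_mult_left[of 0 1 "e / 2" ?K]
      show ?thesis by (simp add: circle_mean_Poisson_kernel[OF w1])
    qed
    finally show ?case using elim eq unfolding w_def dist_real_def by simp
  qed
qed

lemma continuous_on_schwarz:
  fixes Q :: "'b::topological_space \<Rightarrow> complex \<Rightarrow> real"
  assumes "continuous_on (T \<times> sphere 0 1) (\<lambda>(t, u). Q t u)"
  shows "continuous_on (T \<times> ball 0 1) (\<lambda>(t, w). schwarz (Q t) w)"
proof -
  have "continuous_on ((T \<times> ball 0 1) \<times> sphere 0 1) (\<lambda>(p, u). of_real (Q (fst p) u) * herglotz (snd p) u)"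
    unfolding split_beta herglotz_def
    by (intro continuous_intros continuous_on_compose2[OF assms, where f = "\<lambda>p. (fst (fst p), snd p)", simplified split_beta fst_conv snd_conv])
      auto
  from continuous_on_circle_mean[OF this] show ?thesis
    by (simp add: schwarz_def split_beta)
qed

lemma LK_P_eq_schwarz:
  assumes "continuous_on (sphere 0 1) (deriv (f t))" "\<And>u. u \<in> sphere 0 1 \<Longrightarrow> deriv (f t) u \<noteq> 0" "cmod w < 1"
  shows "LK_P q f t w = schwarz (\<lambda>u. q t / (cmod (deriv (f t) u))\<^sup>2) w"
proof -
  let ?F = "\<lambda>z. of_real (q t / (cmod (deriv (f t) z))\<^sup>2) * ((z + w) / (z - w)) / z"
  have "continuous_on (sphere 0 1) ?F"
    using assms by (intro continuous_intros) auto
  from contour_integral_circle_mean[OF this]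
  have "LK_P q f t w = circle_mean 0 1 (\<lambda>u. ?F u * (u - 0))"
    by (simp add: LK_P_def)
  also have "\<dots> = schwarz (\<lambda>u. q t / (cmod (deriv (f t) u))\<^sup>2) w"
    unfolding schwarz_def by (intro circle_mean_cong) (auto simp: herglotz_def)
  finally show ?thesis .
qed

subsection \<open>Families of holomorphic functions depending on a real parameter\<close>

lemma circle_mean_unit:
  "circle_mean z r F = circle_mean 0 1 (\<lambda>u. F (z + of_real r * u))"
  by (simp add: circle_mean_def circlepath)

lemma continuous_on_locally:
  fixes f :: "'a::t2_space \<Rightarrow> 'b::topological_space"
  assumes "\<And>x. x \<in> S \<Longrightarrow> \<exists>T. open T \<and> x \<in> T \<and> continuous_on (S \<inter> T) f"
  shows "continuous_on S f"
  unfolding continuous_on_eq_continuous_within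
proof
  fix x assume x: "x \<in> S"
  then obtain T where T: "open T" "x \<in> T" "continuous_on (S \<inter> T) f" using assms by blast
  have "at x within S = at x within (S \<inter> T)"
    using T by (intro at_within_nhd[of x T]) auto
  thus "continuous (at x within S) f"
    using T x by (simp add: continuous_on_eq_continuous_within)
qed

lemma continuous_on_section:
  assumes "continuous_on (J \<times> U) (\<lambda>(t, z). F t z)" "t \<in> J"
  shows "continuous_on U (F t)"
  using continuous_on_compose2[OF assms(1), of U "\<lambda>z. (t, z)"] assms(2)
  by (simp add: image_subset_iff continuous_on_Pair)

text \<open>Rescaling to the unit circle makes the centre z a parameter of the integrand over a
  fixed circle, as needed for joint continuity of the derivative in time and space.\<close>

lemma deriv_eq_circle_mean:
  assumes "f holomorphic_on U" "open U" "cball z r \<subseteq> U" "r > 0"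
  shows "deriv f z = circle_mean 0 1 (\<lambda>u. f (z + of_real r * u) / (of_real r * u))"
proof -
  have "f holomorphic_on cball z r" using assms(1,3) holomorphic_on_subset by blast
  hence "deriv f z = circle_mean z r (\<lambda>u. f u / (u - z))"
    using assms(4) by (intro deriv_circle_mean[symmetric] holomorphic_on_imp_continuous_on)
       (auto elim: holomorphic_on_subset)
  thus ?thesis by (subst (asm) circle_mean_unit) simp
qed

lemma continuous_on_deriv_family:
  fixes F :: "'t::t2_space \<Rightarrow> complex \<Rightarrow> complex"
  assumes "open U" "\<And>t. t \<in> J \<Longrightarrow> F t holomorphic_on U"
    "continuous_on (J \<times> U) (\<lambda>(t, z). F t z)"
  shows "continuous_on (J \<times> U) (\<lambda>(t, z). deriv (F t) z)"
proof (rule continuous_on_locally, clarify)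
  fix t0 z0 assume t0: "t0 \<in> J" and z0: "z0 \<in> U"
  \<comment> \<open>The doubled radius leaves room for circles of one common radius r around all
    centres in \<open>ball z0 r\<close>.\<close>
  obtain r where r: "r > 0" "cball z0 (2 * r) \<subseteq> U"
  proof -
    obtain e where "e > 0" "cball z0 e \<subseteq> U" using assms(1) z0 open_contains_cball by blast
    thus ?thesis using that[of "e / 2"] by simp
  qed
  have sub: "cball z r \<subseteq> U" if "z \<in> ball z0 r" for z
  proof
    fix w assume "w \<in> cball z r"
    hence "dist z0 w \<le> 2 * r" using that dist_triangle[of z0 w z] by simp
    thus "w \<in> U" using r by auto
  qed
  have "continuous_on ((J \<times> ball z0 r) \<times> sphere 0 1)
     (\<lambda>(p, u). F (fst p) (snd p + of_real r * u) / (of_real r * u))"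
  proof -
    have "(fst (fst p), snd (fst p) + of_real r * snd p) \<in> J \<times> U" if "p \<in> (J \<times> ball z0 r) \<times> sphere 0 1" for p
      using that sub[of "snd (fst p)"] r(1) by (auto simp: dist_norm norm_mult subset_iff)
    thus ?thesis unfolding split_beta using r(1)
      by (intro continuous_intros continuous_on_compose2[OF assms(3), where f = "\<lambda>p. (fst (fst p), snd (fst p) + of_real r * snd p)", simplified split_beta fst_conv snd_conv])
        auto
  qed
  from continuous_on_circle_mean[OF this]
  have "continuous_on (J \<times> ball z0 r) (\<lambda>p. circle_mean 0 1 (\<lambda>u. F (fst p) (snd p + of_real r * u) / (of_real r * u)))"
    by simp
  hence "continuous_on (J \<times> ball z0 r) (\<lambda>(t, z). deriv (F t) z)"
    by (rule continuous_on_cong[THEN iffD1, rotated -1])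
      (auto simp: deriv_eq_circle_mean[OF assms(2,1) sub r(1)])
  moreover have "(J \<times> U) \<inter> (UNIV \<times> ball z0 r) \<subseteq> J \<times> ball z0 r" by auto
  ultimately have "continuous_on ((J \<times> U) \<inter> (UNIV \<times> ball z0 r)) (\<lambda>(t, z). deriv (F t) z)"
    by (rule continuous_on_subset)
  thus "\<exists>T. open T \<and> (t0, z0) \<in> T \<and> continuous_on (J \<times> U \<inter> T) (\<lambda>(t, z). deriv (F t) z)"
    using r(1) by (intro exI[of _ "UNIV \<times> ball z0 r"]) (auto intro!: open_Times)
qed

text \<open>\<open>F'\<close> is the time derivative, while \<open>deriv\<close> always acts in
  space. The set \<open>J\<close> of times need not be open: convexity serves the Leibniz rule, and
  the absence of isolated points makes derivatives within \<open>J\<close> unique and supplies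
  sequences of other times. Holomorphy of \<open>F'\<close> is derived below.\<close>

locale C1_family =
  fixes J :: "real set" and U :: "complex set" and F F' :: "real \<Rightarrow> complex \<Rightarrow> complex"
  assumes convex_J: "convex J" and islimpt_J: "\<And>t. t \<in> J \<Longrightarrow> t islimpt J" and open_U: "open U"
    and holomorphic: "\<And>t. t \<in> J \<Longrightarrow> F t holomorphic_on U"
    and continuous: "continuous_on (J \<times> U) (\<lambda>(t, z). F t z)"
    and continuous': "continuous_on (J \<times> U) (\<lambda>(t, z). F' t z)"
    and vector_derivative: "\<And>t z. t \<in> J \<Longrightarrow> z \<in> U \<Longrightarrow>
        ((\<lambda>s. F s z) has_vector_derivative F' t z) (at t within J)"
begin

text \<open>The kernel \<open>K\<close> is kept general: with the Cauchy kernel it yields holomorphy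
  of the time derivative, with the kernel 1 / (u - z) the interchange of the two
  derivatives.\<close>

lemma has_vector_derivative_circle_mean:
  assumes "t \<in> J" "r > 0" "sphere z r \<subseteq> U" "continuous_on (sphere z r) K"
  shows "((\<lambda>s. circle_mean z r (\<lambda>u. F s u * K u)) has_vector_derivative
          circle_mean z r (\<lambda>u. F' t u * K u)) (at t within J)"
proof -
  let ?c = "circlepath z r"
  have c: "?c x \<in> U" for x
    using assms(2,3) circlepath_in_sphere[of r z x] by (auto simp del: circlepath_in_sphere)
  have K: "continuous_on S (\<lambda>x. K (?c (g x)))" if "continuous_on S g" for S and g :: "'d::topological_space \<Rightarrow> real"
    by (rule continuous_on_compose2[OF assms(4)])
       (use assms(2) that in \<open>auto intro!: continuous_intros simp del: mem_sphere\<close>)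
  have "((\<lambda>s. integral (cbox 0 1) (\<lambda>x. F s (?c x) * K (?c x))) has_vector_derivative
     integral (cbox 0 1) (\<lambda>x. F' t (?c x) * K (?c x))) (at t within J)"
  proof (rule leibniz_rule_vector_derivative[OF _ _ _ assms(1) convex_J])
    show "((\<lambda>s. F s (?c x) * K (?c x)) has_vector_derivative F' s (?c x) * K (?c x)) (at s within J)"
      if "s \<in> J" "x \<in> cbox 0 1" for s x
      using vector_derivative[OF that(1) c] by (intro derivative_intros)
    show "(\<lambda>x. F s (?c x) * K (?c x)) integrable_on cbox 0 1" if "s \<in> J" for s
      using that c by (intro integrable_continuous continuous_intros K
         continuous_on_compose2[OF continuous_on_section[OF continuous]]) auto
    show "continuous_on (J \<times> cbox 0 1) (\<lambda>(s, x). F' s (?c x) * K (?c x))"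
      unfolding split_beta using c
      by (intro continuous_intros K continuous_on_compose2[OF continuous', where f = "\<lambda>p. (fst p, ?c (snd p))", simplified split_beta fst_conv snd_conv]) auto
  qed
  thus ?thesis by (simp add: circle_mean_def)
qed

lemma vector_derivative_unique:
  assumes "t \<in> J" "(f has_vector_derivative a) (at t within J)" "(f has_vector_derivative b) (at t within J)"
  shows "a = b"
  using vector_derivative_unique_within[OF _ assms(2,3)] islimpt_J[OF assms(1)]
  by (simp add: trivial_limit_within)

text \<open>Differentiating Cauchy's formula for \<open>F s\<close> in s shows, by uniqueness of
  derivatives in time, that \<open>F' t\<close> is itself a Cauchy integral of its values on a
  circle.\<close>

lemma holomorphic':
  assumes t: "t \<in> J"
  shows "F' t holomorphic_on U"
proof -
  have "\<exists>r>0. F' t holomorphic_on ball z0 r" if z0: "z0 \<in> U" for z0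
  proof -
    obtain r where r: "r > 0" "cball z0 r \<subseteq> U" using open_U z0 open_contains_cball by blast
    have s: "sphere z0 r \<subseteq> U" using r sphere_cball by blast
    have "F' t z = circle_mean z0 r (\<lambda>u. F' t u * (u - z0) / (u - z))" if z: "z \<in> ball z0 r" for z
    proof (rule vector_derivative_unique[OF t])
      have zU: "z \<in> U" using r z by auto
      show "((\<lambda>s. F s z) has_vector_derivative F' t z) (at t within J)"
        by (rule vector_derivative[OF t zU])
      have "((\<lambda>s. circle_mean z0 r (\<lambda>u. F s u * ((u - z0) / (u - z)))) has_vector_derivative
          circle_mean z0 r (\<lambda>u. F' t u * ((u - z0) / (u - z)))) (at t within J)"
        using z by (intro has_vector_derivative_circle_mean t r s continuous_intros) auto
      moreover have "circle_mean z0 r (\<lambda>u. F s u * ((u - z0) / (u - z))) = F s z" if "s \<in> J" for s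
      proof -
        have "F s holomorphic_on cball z0 r" using holomorphic[OF that] r(2) holomorphic_on_subset by blast
        hence "continuous_on (cball z0 r) (F s)" "F s holomorphic_on ball z0 r"
          using holomorphic_on_imp_continuous_on holomorphic_on_subset ball_subset_cball by blast+
        thus ?thesis using Cauchy_circle_mean[of z0 r "F s" z] z by simp
      qed
      ultimately have "((\<lambda>s. F s z) has_vector_derivative circle_mean z0 r (\<lambda>u. F' t u * ((u - z0) / (u - z)))) (at t within J)"
        by (elim has_vector_derivative_transform[OF t, rotated]) (rule sym)
      thus "((\<lambda>s. F s z) has_vector_derivative circle_mean z0 r (\<lambda>u. F' t u * (u - z0) / (u - z))) (at t within J)"
        by simp
    qed
    moreover have "(\<lambda>z. circle_mean z0 r (\<lambda>u. F' t u * (u - z0) / (u - z))) holomorphic_on ball z0 r"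
      by (intro holomorphic_on_Cauchy_mean continuous_on_subset[OF continuous_on_section[OF continuous' t] s])
    ultimately have "F' t holomorphic_on ball z0 r" using holomorphic_transform by fastforce
    thus ?thesis using r by blast
  qed
  thus ?thesis
    using open_U by (metis analytic_on_def analytic_on_open)
qed

text \<open>Time and space derivatives commute because the space derivative is a circle mean. As the
  result is again a \<open>C1_family\<close>, the passage can be iterated.\<close>

lemma C1_family_deriv: "C1_family J U (\<lambda>t. deriv (F t)) (\<lambda>t. deriv (F' t))"
proof
  show "deriv (F t) holomorphic_on U" if "t \<in> J" for t
    by (intro holomorphic_deriv holomorphic open_U that)
  show "continuous_on (J \<times> U) (\<lambda>(t, z). deriv (F t) z)"
    by (intro continuous_on_deriv_family open_U holomorphic continuous)
  show "continuous_on (J \<times> U) (\<lambda>(t, z). deriv (F' t) z)"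
    by (intro continuous_on_deriv_family open_U holomorphic' continuous')
  fix t z assume t: "t \<in> J" and z: "z \<in> U"
  obtain r where r: "r > 0" "cball z r \<subseteq> U" using open_U z open_contains_cball by blast
  have s: "sphere z r \<subseteq> U" using r sphere_cball by blast
  have "((\<lambda>s. circle_mean z r (\<lambda>u. F s u * (1 / (u - z)))) has_vector_derivative
          circle_mean z r (\<lambda>u. F' t u * (1 / (u - z)))) (at t within J)"
    using r by (intro has_vector_derivative_circle_mean t r s continuous_intros) auto
  moreover have eq: "circle_mean z r (\<lambda>u. G u * (1 / (u - z))) = deriv G z" if "G holomorphic_on U" for G
  proof -
    have "G holomorphic_on cball z r" using that r(2) holomorphic_on_subset by blast
    hence "continuous_on (cball z r) G" "G holomorphic_on ball z r"
      using holomorphic_on_imp_continuous_on holomorphic_on_subset ball_subset_cball by blast+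
    thus ?thesis using deriv_circle_mean[of z r G] r(1) by simp
  qed
  ultimately have "((\<lambda>s. circle_mean z r (\<lambda>u. F s u * (1 / (u - z)))) has_vector_derivative deriv (F' t) z) (at t within J)"
    using holomorphic'[OF t] by simp
  thus "((\<lambda>s. deriv (F s) z) has_vector_derivative deriv (F' t) z) (at t within J)"
    by (rule has_vector_derivative_transform[OF t _, rotated]) (intro eq[symmetric] holomorphic)
qed (use convex_J islimpt_J open_U in auto)

lemma has_derivative:
  assumes "t0 \<in> J" "z0 \<in> U"
  shows "((\<lambda>(t, z). F t z) has_derivative (\<lambda>(dt, dz). dt *\<^sub>R F' t0 z0 + deriv (F t0) z0 * dz))
    (at (t0, z0) within J \<times> U)"
proof -
  obtain r where r: "r > 0" "ball z0 r \<subseteq> U" using open_U assms(2) open_contains_ball by blast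
  have d: "continuous_on (J \<times> U) (\<lambda>(t, z). deriv (F t) z)"
    by (intro continuous_on_deriv_family open_U holomorphic continuous)
  \<comment> \<open>The criterion through partial derivatives asks for a convex set in the second
    variable, hence a ball in place of \<open>U\<close>; at the point in question both give the same
    filter.\<close>
  have "((\<lambda>(t, z). F t z) has_derivative (\<lambda>(dt, dz). dt *\<^sub>R F' t0 z0 + blinfun_mult_right (deriv (F t0) z0) dz))
    (at (t0, z0) within J \<times> ball z0 r)"
  proof (rule has_derivative_partialsI)
    show "((\<lambda>t. F t z0) has_derivative (\<lambda>dt. dt *\<^sub>R F' t0 z0)) (at t0 within J)"
      using vector_derivative[OF assms] by (simp add: has_vector_derivative_def)
    show "((\<lambda>z. F t z) has_derivative blinfun_apply (blinfun_mult_right (deriv (F t) z))) (at z within ball z0 r)"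
      if "t \<in> J" "z \<in> ball z0 r" for t z
    proof -
      have "z \<in> U" using that r by auto
      hence "(F t has_field_derivative deriv (F t) z) (at z)"
        using holomorphic[OF that(1)] open_U holomorphic_derivI by blast
      thus ?thesis
        by (auto simp: has_field_derivative_def intro: has_derivative_at_withinI)
    qed
    have "continuous_on (J \<times> U) (\<lambda>(t, z). blinfun_mult_right (deriv (F t) z))"
      using d by (auto simp: split_beta intro!: continuous_intros)
    hence "continuous_on (J \<times> ball z0 r) (\<lambda>(t, z). blinfun_mult_right (deriv (F t) z))"
      by (rule continuous_on_subset) (use r in auto)
    thus "continuous (at (t0, z0) within J \<times> ball z0 r) (\<lambda>(t, z). blinfun_mult_right (deriv (F t) z))"
      using assms r by (auto simp: continuous_on_eq_continuous_within)
  qed (use r in auto)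
  moreover have "at (t0, z0) within J \<times> ball z0 r = at (t0, z0) within J \<times> U"
    using r by (intro at_within_nhd[of _ "UNIV \<times> ball z0 r"]) (auto intro!: open_Times)
  ultimately show ?thesis by simp
qed

lemma has_vector_derivative_curve:
  assumes "T \<subseteq> J" "t \<in> T" "\<And>s. s \<in> T \<Longrightarrow> w s \<in> U" "(w has_vector_derivative w') (at t within T)"
  shows "((\<lambda>s. F s (w s)) has_vector_derivative F' t (w t) + deriv (F t) (w t) * w') (at t within T)"
proof -
  have "((\<lambda>s. (s, w s)) has_derivative (\<lambda>h. (h, h *\<^sub>R w'))) (at t within T)"
    using assms(4) by (auto simp: has_vector_derivative_def intro!: derivative_eq_intros)
  moreover have "((\<lambda>(t, z). F t z) has_derivative (\<lambda>(dt, dz). dt *\<^sub>R F' t (w t) + deriv (F t) (w t) * dz))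
    (at (t, w t) within (\<lambda>s. (s, w s)) ` T)"
    by (rule has_derivative_subset[OF has_derivative]) (use assms in auto)
  ultimately have "((\<lambda>(t, z). F t z) \<circ> (\<lambda>s. (s, w s)) has_derivative
     (\<lambda>(dt, dz). dt *\<^sub>R F' t (w t) + deriv (F t) (w t) * dz) \<circ> (\<lambda>h. (h, h *\<^sub>R w'))) (at t within T)"
    by (rule diff_chain_within)
  thus ?thesis
    by (simp add: has_vector_derivative_def o_def scaleR_add_right)
qed

section \<open>Points on a level set near a given time\<close>

lemma level_curve_estimate:
  assumes "t0 \<in> J" "z0 \<in> U" "e > 0"
    and s: "\<And>n. s n \<in> J" "s \<longlonglongrightarrow> t0" and w: "\<And>n. w n \<in> U" "w \<longlonglongrightarrow> z0"
    and level: "\<And>n. F (s n) (w n) = F t0 z0"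
  shows "\<forall>\<^sub>F n in sequentially. cmod ((s n - t0) *\<^sub>R F' t0 z0 + deriv (F t0) z0 * (w n - z0))
      \<le> e * (\<bar>s n - t0\<bar> + cmod (w n - z0))"
proof -
  obtain d where d: "d > 0" "\<And>y. y \<in> J \<times> U \<Longrightarrow> norm (y - (t0, z0)) < d \<Longrightarrow>
      norm ((\<lambda>(t, z). F t z) y - F t0 z0 - (\<lambda>(dt, dz). dt *\<^sub>R F' t0 z0 + deriv (F t0) z0 * dz) (y - (t0, z0)))
        \<le> e * norm (y - (t0, z0))"
    using has_derivative[OF assms(1,2)] assms(3) unfolding has_derivative_within_alt by (auto simp: split_beta)
  have "(\<lambda>n. (s n, w n)) \<longlonglongrightarrow> (t0, z0)" by (intro tendsto_Pair s w)
  hence "\<forall>\<^sub>F n in sequentially. dist (s n, w n) (t0, z0) < d" by (rule tendstoD) (fact d)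
  thus ?thesis
  proof eventually_elim
    case (elim n)
    have "norm (0 - ((s n - t0) *\<^sub>R F' t0 z0 + deriv (F t0) z0 * (w n - z0))) \<le> e * norm (s n - t0, w n - z0)"
      using d(2)[of "(s n, w n)"] elim s(1)[of n] w(1)[of n] level[of n] by (simp add: dist_norm)
    also have "\<dots> \<le> e * (\<bar>s n - t0\<bar> + cmod (w n - z0))"
      using assms(3) norm_Pair_le[of "s n - t0" "w n - z0"] by (intro mult_left_mono) auto
    finally show ?case by (simp only: norm_minus_cancel diff_0)
  qed
qed

text \<open>The choice of error c / 2 lets half of c |w - \<open>z0\<close>| absorb the displacement
  part of the remainder, so that the time difference alone bounds the displacement. No curve of
  solutions is constructed; any points on the level set will do.\<close>

lemma level_curve_Lipschitz:
  assumes "t0 \<in> J" "z0 \<in> U" "deriv (F t0) z0 \<noteq> 0"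
    and s: "\<And>n. s n \<in> J" "s \<longlonglongrightarrow> t0" and w: "\<And>n. w n \<in> U" "w \<longlonglongrightarrow> z0"
    and level: "\<And>n. F (s n) (w n) = F t0 z0"
  shows "\<exists>C. \<forall>\<^sub>F n in sequentially. cmod (w n - z0) \<le> C * \<bar>s n - t0\<bar>"
proof -
  define c where "c = cmod (deriv (F t0) z0)"
  have c: "c > 0" using assms(3) by (simp add: c_def)
  have "\<forall>\<^sub>F n in sequentially. cmod ((s n - t0) *\<^sub>R F' t0 z0 + deriv (F t0) z0 * (w n - z0))
      \<le> c / 2 * (\<bar>s n - t0\<bar> + cmod (w n - z0))"
    using assms c by (intro level_curve_estimate) auto
  hence "\<forall>\<^sub>F n in sequentially. cmod (w n - z0) \<le> (1 + 2 * cmod (F' t0 z0) / c) * \<bar>s n - t0\<bar>"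
  proof eventually_elim
    case (elim n)
    have "c * cmod (w n - z0) = cmod (deriv (F t0) z0 * (w n - z0))" by (simp add: c_def norm_mult)
    also have "\<dots> \<le> cmod ((s n - t0) *\<^sub>R F' t0 z0 + deriv (F t0) z0 * (w n - z0)) + cmod ((s n - t0) *\<^sub>R F' t0 z0)"
      using norm_triangle_ineq4[of "(s n - t0) *\<^sub>R F' t0 z0 + deriv (F t0) z0 * (w n - z0)" "(s n - t0) *\<^sub>R F' t0 z0"] by simp
    also have "\<dots> \<le> c / 2 * (\<bar>s n - t0\<bar> + cmod (w n - z0)) + \<bar>s n - t0\<bar> * cmod (F' t0 z0)"
      using elim by simp
    finally have "c * cmod (w n - z0) \<le> (c + 2 * cmod (F' t0 z0)) * \<bar>s n - t0\<bar>"
      by (simp add: algebra_simps)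
    thus ?case using c by (simp add: field_simps)
  qed
  thus ?thesis by blast
qed

text \<open>With zero space derivative, the time term is the only linear term left. A displacement
  of order |s - \<open>t0\<close>| keeps the remainder of smaller order than |s -
  \<open>t0\<close>|, so division by this nonzero number forces the time derivative to
  vanish.\<close>

lemma time_derivative_zero_at_critical_point:
  assumes "t0 \<in> J" "z0 \<in> U" "deriv (F t0) z0 = 0"
    and s: "\<And>n. s n \<in> J" "s \<longlonglongrightarrow> t0" "\<And>n. s n \<noteq> t0" and w: "\<And>n. w n \<in> U" 
    and level: "\<And>n. F (s n) (w n) = F t0 z0"
    and C: "\<forall>\<^sub>F n in sequentially. cmod (w n - z0) \<le> C * \<bar>s n - t0\<bar>"
  shows "F' t0 z0 = 0"
proof -
  have "(\<lambda>n. C * \<bar>s n - t0\<bar>) \<longlonglongrightarrow> C * \<bar>t0 - t0\<bar>" by (intro tendsto_intros s)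
  hence "(\<lambda>n. w n - z0) \<longlonglongrightarrow> 0" by (intro Lim_null_comparison[OF C]) simp
  hence lim: "w \<longlonglongrightarrow> z0" by (rule LIM_zero_cancel)
  have le: "cmod (F' t0 z0) \<le> e" if "e > 0" for e
  proof -
    have "\<forall>\<^sub>F n in sequentially. cmod ((s n - t0) *\<^sub>R F' t0 z0 + deriv (F t0) z0 * (w n - z0))
      \<le> e / (1 + \<bar>C\<bar>) * (\<bar>s n - t0\<bar> + cmod (w n - z0))"
      using assms lim that by (intro level_curve_estimate) auto
    with C have "\<forall>\<^sub>F n in sequentially. cmod (F' t0 z0) \<le> e"
    proof eventually_elim
      case (elim n)
      have "\<bar>s n - t0\<bar> * cmod (F' t0 z0) \<le> e / (1 + \<bar>C\<bar>) * (\<bar>s n - t0\<bar> + cmod (w n - z0))"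
        using elim(2) assms(3) by simp
      also have "\<dots> \<le> e / (1 + \<bar>C\<bar>) * (\<bar>s n - t0\<bar> + \<bar>C\<bar> * \<bar>s n - t0\<bar>)"
        using elim(1) that by (intro mult_left_mono add_left_mono order.trans[OF elim(1)] mult_right_mono) auto
      also have "\<dots> = \<bar>s n - t0\<bar> * e"
        by (simp add: field_simps add_nonneg_eq_0_iff)
      finally show ?case using s(3)[of n] by simp
    qed
    thus ?thesis by simp
  qed
  have "cmod (F' t0 z0) \<le> 0" by (rule field_le_epsilon) (use le in auto)
  thus ?thesis by simp
qed

end

lemma (in C1_family) C1_family_higher_deriv:
  "C1_family J U (\<lambda>t. (deriv ^^ k) (F t)) (\<lambda>t. (deriv ^^ k) (F' t))"
proof (induction k)
  case (Suc k)
  from C1_family.C1_family_deriv[OF this] show ?case by simp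
qed (use C1_family_axioms in simp)

subsection \<open>Quotients of holomorphic functions\<close>

text \<open>Divisibility of germs of holomorphic functions. Written as a product, it also makes
  sense at zeros of \<open>b\<close>, where a quotient would need a separately chosen value.\<close>

definition divides_at :: "(complex \<Rightarrow> complex) \<Rightarrow> (complex \<Rightarrow> complex) \<Rightarrow> complex \<Rightarrow> bool" where
  "divides_at b a w \<longleftrightarrow>
    (\<exists>r>0. \<exists>h. h holomorphic_on ball w r \<and> (\<forall>z\<in>ball w r. a z = b z * h z))"

lemma open_divides_at: "open {w. divides_at b a w}"
proof (rule openI, clarify)
  fix w assume "divides_at b a w"
  then obtain r h where rh: "r > 0" "h holomorphic_on ball w r" "\<forall>z\<in>ball w r. a z = b z * h z"
    unfolding divides_at_def by blast
  have "divides_at b a z" if z: "z \<in> ball w r" for z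
  proof -
    obtain d where d: "d > 0" "ball z d \<subseteq> ball w r"
      using z open_contains_ball_eq[OF open_ball] by metis
    thus ?thesis unfolding divides_at_def
      using rh holomorphic_on_subset[OF rh(2) d(2)] by (metis subsetD)
  qed
  thus "\<exists>e>0. ball w e \<subseteq> {w. divides_at b a w}" using rh(1) by blast
qed

lemma divides_at_nonzero:
  assumes "a holomorphic_on V" "b holomorphic_on V" "open V" "w \<in> V" "b w \<noteq> 0"
  shows "divides_at b a w"
proof -
  have "continuous_on V b" using assms holomorphic_on_imp_continuous_on by blast
  hence "open (V \<inter> b -` (- {0}))"
    using assms(3) by (intro continuous_open_preimage) auto
  then obtain r where r: "r > 0" "ball w r \<subseteq> V \<inter> b -` (- {0})"
    using assms(4,5) open_contains_ball by blast
  have "(\<lambda>z. a z / b z) holomorphic_on ball w r"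
    using r assms(1,2) by (intro holomorphic_intros) (auto elim: holomorphic_on_subset)
  thus ?thesis unfolding divides_at_def using r by (intro exI[of _ r] conjI exI[of _ "\<lambda>z. a z / b z"]) auto
qed

lemma divides_at_imp_quotient:
  assumes "open V" "\<And>w. w \<in> V \<Longrightarrow> divides_at b a w"
    "\<And>w. w \<in> V \<Longrightarrow> \<forall>\<^sub>F z in at w. b z \<noteq> 0"
  obtains p where "p holomorphic_on V" "\<And>z. z \<in> V \<Longrightarrow> a z = b z * p z"
proof -
  have "\<forall>w\<in>V. \<exists>r h. r > 0 \<and> h holomorphic_on ball w r \<and> (\<forall>z\<in>ball w r. a z = b z * h z)"
    using assms(2) unfolding divides_at_def by blast
  then obtain r h where rh: "\<And>w. w \<in> V \<Longrightarrow> r w > 0" "\<And>w. w \<in> V \<Longrightarrow> h w holomorphic_on ball w (r w)"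
     "\<And>w z. w \<in> V \<Longrightarrow> z \<in> ball w (r w) \<Longrightarrow> a z = b z * h w z"
    by metis
  \<comment> \<open>Each point uses the value there of its own local quotient. Near w these values
    agree with \<open>h w\<close>: away from w because \<open>b\<close> is nonzero, at w by
    definition.\<close>
  define p where "p = (\<lambda>z. h z z)"
  have eq: "a z = b z * p z" if "z \<in> V" for z
    using rh(3)[OF that, of z] rh(1)[OF that] by (simp add: p_def)
  have "\<exists>d>0. p holomorphic_on ball w d" if w: "w \<in> V" for w
  proof -
    obtain d1 where d1: "d1 > 0" "\<And>z. dist z w < d1 \<Longrightarrow> z \<noteq> w \<Longrightarrow> b z \<noteq> 0"
      using assms(3)[OF w] unfolding eventually_at by auto
    obtain d2 where d2: "d2 > 0" "ball w d2 \<subseteq> V" using assms(1) w open_contains_ball by blast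
    define d where "d = min (r w) (min d1 d2)"
    have "p z = h w z" if z: "z \<in> ball w d" for z
    proof (cases "z = w")
      case False
      have "z \<in> V" "z \<in> ball w (r w)" "b z \<noteq> 0" using z False d1 d2 by (auto simp: d_def dist_commute)
      thus ?thesis using eq[of z] rh(3)[OF w, of z] by simp
    qed (simp add: p_def)
    moreover have "h w holomorphic_on ball w d"
      by (rule holomorphic_on_subset[OF rh(2)[OF w]]) (simp add: d_def subset_ball)
    ultimately have "p holomorphic_on ball w d" using holomorphic_transform by metis
    thus ?thesis using rh(1)[OF w] d1 d2 by (intro exI[of _ d]) (auto simp: d_def)
  qed
  hence "p analytic_on V" unfolding analytic_on_def by blast
  hence "p holomorphic_on V" using analytic_imp_holomorphic by blast
  thus ?thesis using eq that by blast
qed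

text \<open>The order of the zero may exceed m or be infinite, so \<open>g\<close> is allowed to
  vanish at w.\<close>

lemma holomorphic_factor_power:
  assumes "a holomorphic_on V" "open V" "w \<in> V" "\<And>k. k < m \<Longrightarrow> (deriv ^^ k) a w = 0"
  obtains r g where "r > 0" "g holomorphic_on ball w r" "\<And>z. z \<in> ball w r \<Longrightarrow> a z = (z - w) ^ m * g z"
proof -
  obtain R where R: "R > 0" "ball w R \<subseteq> V" using assms open_contains_ball by blast
  have aR: "a holomorphic_on ball w R" using assms R holomorphic_on_subset by blast
  show ?thesis
  proof (cases "m = 0 \<or> (\<forall>k. (deriv ^^ k) a w = 0)")
    case True
    thus ?thesis
    proof
      assume "m = 0"
      thus ?thesis using that[OF R(1) aR] by simp
    next
      assume z: "\<forall>k. (deriv ^^ k) a w = 0"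
      have "a z = 0" if "z \<in> ball w R" for z
        using holomorphic_fun_eq_0_on_connected[OF aR open_ball connected_ball, of w z] z that R(1) by auto
      thus ?thesis using that[OF R(1), of "\<lambda>_. 0"] by simp
    qed
  next
    case False
    \<comment> \<open>The exact order of the zero; the surplus power n - m is moved into the
      cofactor.\<close>
    define n where "n = (LEAST k. (deriv ^^ k) a w \<noteq> 0)"
    have n: "(deriv ^^ n) a w \<noteq> 0" "\<And>k. k < n \<Longrightarrow> (deriv ^^ k) a w = 0"
      unfolding n_def using False by (metis (mono_tags, lifting) LeastI, metis (mono_tags, lifting) not_less_Least)
    have mn: "m \<le> n" using n(1) assms(4) not_le by blast
    have a0: "a w = 0" using assms(4)[of 0] False by simp
    have "w \<in> ball w R" "0 < n" using R(1) mn False by auto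
    from holomorphic_factor_order_of_zero[OF aR open_ball this n(1)] n(2)
    obtain g r where "0 < r" "g holomorphic_on ball w r"
        "\<And>z. z \<in> ball w r \<Longrightarrow> a z - a w = (z - w)^n * g z"
      by metis
    moreover from this have "a z = (z - w) ^ m * ((z - w) ^ (n - m) * g z)" if "z \<in> ball w r" for z
      using that mn a0 by (simp flip: mult.assoc power_add)
    moreover have "(\<lambda>z. (z - w) ^ (n - m) * g z) holomorphic_on ball w r"
      using calculation by (intro holomorphic_intros)
    ultimately show ?thesis using that by blast
  qed
qed

lemma divides_at_order:
  assumes "a holomorphic_on V" "b holomorphic_on V" "open V" "w \<in> V"
    "(deriv ^^ m) b w \<noteq> 0" "\<And>k. k < m \<Longrightarrow> (deriv ^^ k) b w = 0" "\<And>k. k < m \<Longrightarrow> (deriv ^^ k) a w = 0"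
  shows "divides_at b a w"
proof (cases "m = 0")
  case True
  thus ?thesis using assms divides_at_nonzero[of a V b w] by simp
next
  case False
  hence "0 < m" by simp
  from holomorphic_factor_order_of_zero[OF assms(2,3,4) this assms(5)] assms(6)
  obtain g1 r1 where 1: "0 < r1" "g1 holomorphic_on ball w r1"
      "\<And>z. z \<in> ball w r1 \<Longrightarrow> b z - b w = (z - w)^m * g1 z" "\<And>z. z \<in> ball w r1 \<Longrightarrow> g1 z \<noteq> 0"
    by metis
  have b0: "b w = 0" using assms(6)[of 0] False by simp
  obtain g2 r2 where 2: "0 < r2" "g2 holomorphic_on ball w r2"
      "\<And>z. z \<in> ball w r2 \<Longrightarrow> a z = (z - w)^m * g2 z"
    using holomorphic_factor_power[OF assms(1,3,4,7)] by blast
  define r where "r = min r1 r2"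
  have "g1 holomorphic_on ball w r" "g2 holomorphic_on ball w r"
    using 1(2) 2(2) by (auto simp: r_def elim!: holomorphic_on_subset)
  hence "(\<lambda>z. g2 z / g1 z) holomorphic_on ball w r"
    using 1(4) by (intro holomorphic_intros) (auto simp: r_def)
  moreover have "a z = b z * (g2 z / g1 z)" if "z \<in> ball w r" for z
    using 1(3)[of z] 1(4)[of z] 2(3)[of z] that b0 by (simp add: r_def)
  ultimately show ?thesis unfolding divides_at_def using 1(1) 2(1)
    by (intro exI[of _ r] conjI exI[of _ "\<lambda>z. g2 z / g1 z"]) (auto simp: r_def)
qed

lemma eventually_nonzero_at:
  assumes "b holomorphic_on U" "open U" "connected U" "\<beta> \<in> U" "b \<beta> \<noteq> 0" "w \<in> U"
  shows "\<forall>\<^sub>F z in at w. b z \<noteq> 0"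
proof (cases "b w = 0")
  case True
  then obtain r where "0 < r" "\<And>z. z \<in> ball w r - {w} \<Longrightarrow> b z \<noteq> 0"
    using isolated_zeros[OF assms(1-3,6) True assms(4,5)] by metis
  thus ?thesis unfolding eventually_at by (intro exI[of _ r]) (auto simp: dist_commute)
next
  case False
  have "isCont b w" using assms holomorphic_on_imp_continuous_on continuous_on_eq_continuous_at by blast
  thus ?thesis using False by (metis isCont_def tendsto_imp_eventually_ne)
qed

text \<open>Nonconstancy on a connected domain isolates the critical points, so that local quotients
  by the space derivative agree on overlaps and can be glued.\<close>

locale nonconstant_C1_family = C1_family +
  assumes connected_U: "connected U"
    and nonconstant: "\<And>t. t \<in> J \<Longrightarrow> \<exists>\<beta>\<in>U. deriv (F t) \<beta> \<noteq> 0"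
begin

lemma holomorphic_deriv': "t \<in> J \<Longrightarrow> deriv (F t) holomorphic_on U"
  by (intro holomorphic_deriv holomorphic open_U)

lemma deriv_eventually_nonzero:
  assumes "t \<in> J" "w \<in> U"
  shows "\<forall>\<^sub>F z in at w. deriv (F t) z \<noteq> 0"
  using nonconstant[OF assms(1)] eventually_nonzero_at[OF holomorphic_deriv' open_U connected_U] assms by blast

text \<open>Divisibility of the time derivative by the space derivative is a closed condition in time:
  the quotient is the Cauchy integral of its values on a small circle without critical points.\<close>

lemma divides_at_limit:
  assumes t0: "t0 \<in> J" and \<rho>: "\<rho> > 0" "cball w0 \<rho> \<subseteq> U"
    and nz: "\<And>z. z \<in> sphere w0 \<rho> \<Longrightarrow> deriv (F t0) z \<noteq> 0"
    and s: "\<And>n. s n \<in> J" "s \<longlonglongrightarrow> t0"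
    and div: "\<And>n w. w \<in> cball w0 \<rho> \<Longrightarrow> divides_at (deriv (F (s n))) (F' (s n)) w"
  shows "divides_at (deriv (F t0)) (F' t0) w0"
proof -
  have sU: "sphere w0 \<rho> \<subseteq> U" using \<rho> sphere_cball by blast
  have cd: "continuous_on (J \<times> U) (\<lambda>(t, z). deriv (F t) z)"
    by (intro continuous_on_deriv_family open_U holomorphic continuous)
  have cs: "continuous_on (J \<times> sphere w0 \<rho>) (\<lambda>(t, z). deriv (F t) z)"
    by (rule continuous_on_subset[OF cd]) (use sU in auto)
  have cs': "continuous_on (J \<times> sphere w0 \<rho>) (\<lambda>(t, z). F' t z)"
    by (rule continuous_on_subset[OF continuous']) (use sU in auto)
  have "continuous_on (sphere w0 \<rho>) (\<lambda>z. cmod (deriv (F t0) z))"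
    by (intro continuous_intros continuous_on_section[OF cs t0])
  moreover have "sphere w0 \<rho> \<noteq> {}" using \<rho>(1) by simp
  ultimately obtain z1 where z1: "z1 \<in> sphere w0 \<rho>" "\<And>z. z \<in> sphere w0 \<rho> \<Longrightarrow> cmod (deriv (F t0) z1) \<le> cmod (deriv (F t0) z)"
    using continuous_attains_inf[OF compact_sphere] by metis
  \<comment> \<open>Half the minimum over the circle: a space derivative that differs by at most e
    from the one at \<open>t0\<close> cannot vanish there.\<close>
  define e where "e = cmod (deriv (F t0) z1) / 2"
  have "e > 0" using nz[OF z1(1)] by (simp add: e_def)
  obtain X where X: "t0 \<in> X" "open X" "\<forall>t\<in>X \<inter> J. \<forall>z\<in>sphere w0 \<rho>. dist (deriv (F t) z) (deriv (F t0) z) \<le> e"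
    using continuous_on_prod_compactE[OF cs compact_sphere t0 \<open>e > 0\<close>] by (metis case_prod_conv)
  define K where "K = X \<inter> J"
  have nzK: "deriv (F t) z \<noteq> 0" if "t \<in> K" "z \<in> sphere w0 \<rho>" for t z
  proof
    assume "deriv (F t) z = 0"
    moreover have "dist (deriv (F t) z) (deriv (F t0) z) \<le> e" using X(3) that unfolding K_def by blast
    ultimately have "cmod (deriv (F t0) z) \<le> e" by simp
    thus False using z1(2)[OF that(2)] \<open>e > 0\<close> unfolding e_def by linarith
  qed
  \<comment> \<open>At \<open>t0\<close> this is holomorphic by its boundary values alone, before
    divisibility is known; the factorisation at \<open>t0\<close> is then the limit of those at the
    times \<open>s n\<close>.\<close>
  define H where "H = (\<lambda>t z. circle_mean w0 \<rho> (\<lambda>u. (F' t u / deriv (F t) u) * (u - w0) / (u - z)))"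
  have cH: "continuous_on K (\<lambda>t. H t z)" if "z \<in> ball w0 \<rho>" for z
    unfolding H_def
  proof (intro continuous_on_circle_mean)
    show "continuous_on (K \<times> sphere w0 \<rho>) (\<lambda>(t, u). (F' t u / deriv (F t) u) * (u - w0) / (u - z))"
      unfolding split_beta using that nzK
      by (intro continuous_intros continuous_on_subset[OF cs[unfolded split_beta]] continuous_on_subset[OF cs'[unfolded split_beta]])
        (auto simp: K_def)
  qed (use \<rho> in auto)
  have hH: "H t0 holomorphic_on ball w0 \<rho>"
    unfolding H_def
    by (intro holomorphic_on_Cauchy_mean continuous_intros continuous_on_section[OF cs t0] continuous_on_section[OF cs' t0])
      (use nz in blast)
  have eq: "F' (s n) z = deriv (F (s n)) z * H (s n) z" if n: "s n \<in> K" and z: "z \<in> ball w0 \<rho>" for n z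
  proof -
    \<comment> \<open>Gluing needs an open domain. Since divisibility is an open condition, it holds
      on one around the closed disc.\<close>
    define V where "V = U \<inter> {w. divides_at (deriv (F (s n))) (F' (s n)) w}"
    have "open V" unfolding V_def by (intro open_Int open_U open_divides_at)
    then obtain p where p: "p holomorphic_on V" "\<And>z. z \<in> V \<Longrightarrow> F' (s n) z = deriv (F (s n)) z * p z"
      using divides_at_imp_quotient[of V "deriv (F (s n))" "F' (s n)"] deriv_eventually_nonzero[OF s(1)]
      unfolding V_def by blast
    have V: "cball w0 \<rho> \<subseteq> V" using \<rho> div unfolding V_def by blast
    have "p holomorphic_on cball w0 \<rho>" using p(1) V holomorphic_on_subset by blast
    hence "p z = circle_mean w0 \<rho> (\<lambda>u. p u * (u - w0) / (u - z))"
      using z ball_subset_cball holomorphic_on_subset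
      by (intro Cauchy_circle_mean[symmetric] holomorphic_on_imp_continuous_on) blast+
    also have "\<dots> = H (s n) z" unfolding H_def
    proof (intro circle_mean_cong)
      fix u assume u: "u \<in> sphere w0 \<rho>"
      have "u \<in> V" using u V sphere_cball by blast
      hence "p u = F' (s n) u / deriv (F (s n)) u" using p(2)[of u] nzK[OF n u] by simp
      thus "p u * (u - w0) / (u - z) = F' (s n) u / deriv (F (s n)) u * (u - w0) / (u - z)" by simp
    qed (use \<rho> in auto)
    finally show ?thesis using p(2)[of z] V z by (metis ball_subset_cball subsetD)
  qed
  have ev: "\<forall>\<^sub>F n in sequentially. s n \<in> K"
    using topological_tendstoD[OF s(2) X(2,1)] by eventually_elim (auto simp: K_def s)
  have t0K: "t0 \<in> K" using X t0 by (auto simp: K_def)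
  have "F' t0 z = deriv (F t0) z * H t0 z" if z: "z \<in> ball w0 \<rho>" for z
  proof -
    have zU: "z \<in> U" using z \<rho> by auto
    have "(\<lambda>n. F' (s n) z) \<longlonglongrightarrow> F' t0 z"
      using continuous_on_tendsto_compose[OF continuous' tendsto_Pair[OF s(2) tendsto_const[of z]]] s(1) t0 zU by simp
    moreover have "(\<lambda>n. deriv (F (s n)) z) \<longlonglongrightarrow> deriv (F t0) z"
      using continuous_on_tendsto_compose[OF cd tendsto_Pair[OF s(2) tendsto_const[of z]]] s(1) t0 zU by simp
    moreover have "(\<lambda>n. H (s n) z) \<longlonglongrightarrow> H t0 z"
      using continuous_on_tendsto_compose[OF cH[OF z] s(2) t0K ev] .
    ultimately have "(\<lambda>n. F' (s n) z - deriv (F (s n)) z * H (s n) z) \<longlonglongrightarrow> F' t0 z - deriv (F t0) z * H t0 z"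
      by (intro tendsto_intros)
    moreover have "\<forall>\<^sub>F n in sequentially. F' (s n) z - deriv (F (s n)) z * H (s n) z = 0"
      using ev by eventually_elim (use eq[OF _ z] in simp)
    hence "(\<lambda>n. F' (s n) z - deriv (F (s n)) z * H (s n) z) \<longlonglongrightarrow> 0"
      by (rule tendsto_eventually)
    ultimately have "F' t0 z - deriv (F t0) z * H t0 z = 0" by (rule LIMSEQ_unique)
    thus ?thesis by simp
  qed
  thus ?thesis unfolding divides_at_def using \<rho>(1) hH by blast
qed

text \<open>At a failure of divisibility with minimal order \<open>m\<close> of the critical point, the failure
  persists for nearby times, by closedness and with order at least \<open>m\<close> by minimality. Hence
  the critical point moves along a Lipschitz curve on which all space derivatives of order \<open>1, \<dots>, m\<close>
  vanish; differentiating these identities along the curve shows that the time derivative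
  vanishes to order \<open>m\<close> after all.\<close>

theorem critical_points_stationary_imp_divides_at:
  assumes stat: "\<And>t w. t \<in> J \<Longrightarrow> w \<in> U \<Longrightarrow> deriv (F t) w = 0 \<Longrightarrow> F' t w = 0"
    and "t \<in> J" "w \<in> U"
  shows "divides_at (deriv (F t)) (F' t) w"
proof (rule ccontr)
  define bad where "bad = (\<lambda>t w. t \<in> J \<and> w \<in> U \<and> \<not> divides_at (deriv (F t)) (F' t) w)"
  assume "\<not> divides_at (deriv (F t)) (F' t) w"
  hence bad: "bad t w" using assms by (simp add: bad_def)
  \<comment> \<open>Here m counts the order of the zero of \<open>deriv (F t)\<close>, not of
    \<open>F t\<close>. At a bad point the space derivatives of \<open>F t\<close> of orders 1 to m
    therefore vanish for the least such m, while at the chosen point order m + 1 does not.\<close>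
  define Q where "Q = (\<lambda>m. \<exists>t w. bad t w \<and> (deriv ^^ m) (deriv (F t)) w \<noteq> 0)"
  have "\<exists>m. Q m"
  proof (rule ccontr)
    assume "\<not> (\<exists>m. Q m)"
    hence "\<And>m. (deriv ^^ m) (deriv (F t)) w = 0" using bad by (auto simp: Q_def)
    hence "deriv (F t) z = 0" if "z \<in> U" for z
      using that assms(2,3) holomorphic_fun_eq_0_on_connected[OF holomorphic_deriv'[OF assms(2)] open_U connected_U] by metis
    thus False using nonconstant[OF assms(2)] by auto
  qed
  define m where "m = (LEAST m. Q m)"
  have Qm: "Q m" unfolding m_def using \<open>\<exists>m. Q m\<close> by (rule LeastI_ex)
  have low: "(deriv ^^ k) (deriv (F t)) w = 0" if "k < m" "bad t w" for k t w
    using that not_less_Least[of k Q] unfolding m_def Q_def by blast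
  obtain t0 w0 where bad0: "bad t0 w0" and top: "(deriv ^^ m) (deriv (F t0)) w0 \<noteq> 0"
    using Qm unfolding Q_def by blast
  have t0: "t0 \<in> J" and w0: "w0 \<in> U" using bad0 by (auto simp: bad_def)
  have m0: "m > 0"
  proof (rule ccontr)
    assume "\<not> m > 0"
    hence "deriv (F t0) w0 \<noteq> 0" using top by simp
    thus False using divides_at_nonzero[OF holomorphic' holomorphic_deriv' open_U] t0 w0 bad0 by (auto simp: bad_def)
  qed
  obtain d1 where d1: "d1 > 0" "\<And>z. dist z w0 < d1 \<Longrightarrow> z \<noteq> w0 \<Longrightarrow> deriv (F t0) z \<noteq> 0"
    using deriv_eventually_nonzero[OF t0 w0] unfolding eventually_at by auto
  obtain d2 where d2: "d2 > 0" "cball w0 d2 \<subseteq> U" using open_U w0 open_contains_cball by blast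
  define \<rho> where "\<rho> = min (d1 / 2) d2"
  have \<rho>: "\<rho> > 0" using d1 d2 by (simp add: \<rho>_def)
  \<comment> \<open>If some small disc contained no bad point at times close to \<open>t0\<close>,
    closedness of divisibility would make \<open>w0\<close> good as well.\<close>
  have "\<exists>s w. s \<in> J \<and> s \<noteq> t0 \<and> dist s t0 < 1 / real (Suc n) \<and> dist w w0 \<le> \<rho> / real (Suc n) \<and> bad s w" for n
  proof (rule ccontr)
    assume no: "\<not> ?thesis"
    obtain s where s: "\<And>k. s k \<in> J - {t0}" "s \<longlonglongrightarrow> t0"
      using islimpt_J[OF t0] unfolding islimpt_sequential by blast
    have "\<forall>\<^sub>F k in sequentially. dist (s k) t0 < 1 / real (Suc n)"
      by (rule tendstoD[OF s(2)]) simp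
    then obtain N where N: "\<And>k. k \<ge> N \<Longrightarrow> dist (s k) t0 < 1 / real (Suc n)"
      unfolding eventually_sequentially by blast
    have le: "\<rho> / real (Suc n) \<le> \<rho>" using \<rho> by (simp add: divide_le_eq)
    have "cball w0 \<rho> \<subseteq> U" using d2 by (auto simp: \<rho>_def)
    hence sub: "cball w0 (\<rho> / real (Suc n)) \<subseteq> U" using subset_cball[OF le] by blast
    have "divides_at (deriv (F t0)) (F' t0) w0"
    proof (rule divides_at_limit[OF t0 _ sub])
      show "deriv (F t0) z \<noteq> 0" if "z \<in> sphere w0 (\<rho> / real (Suc n))" for z
      proof (rule d1(2))
        have "dist z w0 = \<rho> / real (Suc n)" using that by (simp add: dist_commute)
        moreover have "\<rho> / real (Suc n) > 0" using \<rho> by simp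
        moreover have "\<rho> < d1" using d1(1) by (simp add: \<rho>_def min_def)
        ultimately show "z \<noteq> w0" "dist z w0 < d1" using le by auto
      qed
      show "s (k + N) \<in> J" for k using s(1) by blast
      show "(\<lambda>k. s (k + N)) \<longlonglongrightarrow> t0" by (rule LIMSEQ_ignore_initial_segment[OF s(2)])
      show "divides_at (deriv (F (s (k + N)))) (F' (s (k + N))) w" if "w \<in> cball w0 (\<rho> / real (Suc n))" for k w
      proof -
        have "w \<in> U" "dist w w0 \<le> \<rho> / real (Suc n)" using that sub by (auto simp: dist_commute)
        thus ?thesis using no s(1)[of "k + N"] N[of "k + N"] unfolding bad_def by auto
      qed
    qed (use \<rho> in simp)
    thus False using bad0 by (simp add: bad_def)
  qed
  then obtain s v where sv: "\<And>n. s n \<in> J" "\<And>n. s n \<noteq> t0" "\<And>n. dist (s n) t0 < 1 / real (Suc n)"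
     "\<And>n. dist (v n) w0 \<le> \<rho> / real (Suc n)" "\<And>n. bad (s n) (v n)"
    by metis
  have vU: "v n \<in> U" for n using sv(5) by (simp add: bad_def)
  have lim_s: "s \<longlonglongrightarrow> t0"
    by (rule metric_tendsto_imp_tendsto[of "\<lambda>n. 1 / real (Suc n)" 0])
      (use sv(3) LIMSEQ_Suc[OF lim_1_over_n] in \<open>auto intro!: always_eventually less_imp_le\<close>)
  have lim_v: "v \<longlonglongrightarrow> w0"
    by (rule metric_tendsto_imp_tendsto[of "\<lambda>n. \<rho> / real (Suc n)" 0])
      (use sv(4) \<rho> LIMSEQ_Suc[OF lim_const_over_n[of \<rho>]] in auto)
  have zero: "(deriv ^^ k) (F t) w = 0" if "0 < k" "k \<le> m" "bad t w" for k t w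
    using low[of "k - 1" t w] that by (cases k) (simp_all add: funpow_Suc_right del: funpow.simps)
  have dz: "deriv ((deriv ^^ k) (F t0)) w0 = (deriv ^^ k) (deriv (F t0)) w0" for k
    using funpow_swap1[of deriv k "F t0"] by simp
  \<comment> \<open>The level set is that of the m-th space derivative, which vanishes at all bad
    points and has nonzero space derivative at (\<open>t0\<close>, \<open>w0\<close>).\<close>
  have "\<exists>C. \<forall>\<^sub>F n in sequentially. cmod (v n - w0) \<le> C * \<bar>s n - t0\<bar>"
    by (rule C1_family.level_curve_Lipschitz[OF C1_family_higher_deriv[of m] t0 w0 _ sv(1) lim_s vU lim_v])
      (use top dz zero[of m] m0 sv(5) bad0 in simp_all)
  then obtain C where C: "\<forall>\<^sub>F n in sequentially. cmod (v n - w0) \<le> C * \<bar>s n - t0\<bar>" by blast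
  have "(deriv ^^ k) (F' t0) w0 = 0" if "k < m" for k
  proof (cases "k = 0")
    \<comment> \<open>For k = 0 the function \<open>F\<close> itself need not be constant along the
      points \<open>v n\<close>, so here the hypothesis on critical points is used instead.\<close>
    case True
    thus ?thesis using stat[OF t0 w0] low[OF m0 bad0] by simp
  next
    case False
    show ?thesis
      by (rule C1_family.time_derivative_zero_at_critical_point[OF C1_family_higher_deriv[of k] t0 w0 _ sv(1) lim_s sv(2) vU _ C])
        (use low dz zero[of k] False that sv(5) bad0 in simp_all)
  qed
  hence "divides_at (deriv (F t0)) (F' t0) w0"
    by (intro divides_at_order[OF holomorphic'[OF t0] holomorphic_deriv'[OF t0] open_U w0 top] low[OF _ bad0])
  thus False using bad0 by (simp add: bad_def)
qed

end

subsection \<open>Subordination\<close>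

text \<open>The bound on \<open>1 - \<phi> z / z\<close> is the Schwarz lemma for \<open>(g - a) / (1 - a g)\<close>
  where \<open>g z = \<phi> z / z\<close>.\<close>

lemma Schwarz_near_identity:
  assumes hol: "\<phi> holomorphic_on ball 0 1" and img: "\<phi> ` ball 0 1 \<subseteq> ball 0 1" and "\<phi> 0 = 0"
    and a: "deriv \<phi> 0 = of_real a" "a > 0" and z: "cmod z < 1"
  shows "cmod (\<phi> z - z) \<le> 2 * (1 - a) / (1 - cmod z)"
proof -
  have no: "norm (\<phi> z) < 1" if "norm z < 1" for z using img that by force
  have le: "norm (\<phi> z) \<le> norm z" if "norm z < 1" for z
    using that by (intro Schwarz_Lemma(1)[OF hol assms(3)] no)
  have "norm (deriv \<phi> 0) \<le> 1"
    by (rule Schwarz_Lemma(2)[OF hol assms(3), of 0]) (auto intro: no)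
  hence a1: "a \<le> 1" using a by simp
  show ?thesis
  \<comment> \<open>In the equality case of the Schwarz lemma \<phi> is a rotation, and its positive
    derivative at 0 makes it the identity. Otherwise the quotient below has modulus less than one
    everywhere, including at 0.\<close>
  proof (cases "(\<exists>z. norm z < 1 \<and> z \<noteq> 0 \<and> norm (\<phi> z) = norm z) \<or> norm (deriv \<phi> 0) = 1")
    case True
    have "\<exists>\<alpha>. (\<forall>z. norm z < 1 \<longrightarrow> \<phi> z = \<alpha> * z) \<and> norm \<alpha> = 1"
      by (rule Schwarz_Lemma(3)[OF hol assms(3), of 0]) (use True in \<open>auto intro: no\<close>)
    then obtain \<alpha> where \<alpha>: "\<And>z. norm z < 1 \<Longrightarrow> \<phi> z = \<alpha> * z" "norm \<alpha> = 1"
      by blast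
    have "((\<lambda>z. \<alpha> * z) has_field_derivative \<alpha>) (at 0)" by (auto intro!: derivative_eq_intros)
    hence "(\<phi> has_field_derivative \<alpha>) (at 0)"
      by (rule has_field_derivative_transform_within_open[of _ _ _ "ball 0 1"]) (auto simp: \<alpha>)
    hence "\<alpha> = of_real a" using a DERIV_imp_deriv by force
    hence "a = 1" using \<alpha>(2) a(2) by simp
    thus ?thesis using \<alpha>(1)[OF z] \<open>\<alpha> = of_real a\<close> by simp
  next
    case False
    hence a1': "a < 1" using a a1 by auto
    define g where "g = (\<lambda>z. if z = 0 then deriv \<phi> 0 else \<phi> z / z)"
    have hg: "g holomorphic_on ball 0 1"
      by (rule pole_theorem_open_0[OF hol open_ball, of 0]) (auto simp: g_def assms(3))
    have g1: "norm (g z) < 1" if "norm z < 1" for z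
      using le[OF that] False that a1' a by (auto simp: g_def norm_divide divide_less_eq less_le)
    have nz: "1 - of_real a * g z \<noteq> 0" if "norm z < 1" for z
    proof
      assume "1 - of_real a * g z = 0"
      hence "cmod (of_real a * g z) = 1" by simp
      moreover have "cmod (of_real a * g z) \<le> 1 * cmod (g z)"
        using a a1 unfolding norm_mult by (intro mult_right_mono) auto
      ultimately show False using g1[OF that] by simp
    qed
    define h where "h = (\<lambda>z. (g z - of_real a) / (1 - of_real a * g z))"
    have hh: "h holomorphic_on ball 0 1"
      unfolding h_def using nz by (intro holomorphic_intros hg) auto
    have h0: "h 0 = 0" by (simp add: h_def g_def a)
    have h1: "norm (h z) < 1" if "norm z < 1" for z
    proof -
      define x where "x = g z"
      have "(1 - a\<^sup>2) * (1 - (cmod x)\<^sup>2) > 0"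
        using a a1' g1[OF that] by (intro mult_pos_pos) (auto simp: power_less_one_iff x_def)
      moreover have "(cmod (1 - of_real a * x))\<^sup>2 - (cmod (x - of_real a))\<^sup>2 = (1 - a\<^sup>2) * (1 - (cmod x)\<^sup>2)"
        unfolding cmod_power2 by (simp add: power2_eq_square algebra_simps)
      ultimately have "(cmod (x - of_real a))\<^sup>2 < (cmod (1 - of_real a * x))\<^sup>2" by linarith
      hence "cmod (x - of_real a) < cmod (1 - of_real a * x)" by (rule power_less_imp_less_base) simp
      thus ?thesis unfolding h_def x_def norm_divide using nz[OF that] by (simp add: divide_less_eq)
    qed
    have hz: "norm (h z) \<le> norm z" by (intro Schwarz_Lemma(1)[OF hh h0] h1 z)
    \<comment> \<open>Solving the definition of \<open>h\<close> for \<open>g\<close> gives g = (h +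
      a) / (1 + a h), and subtraction from 1 isolates the small factor 1 - a.\<close>
    have "(1 - g z) * (1 + of_real a * h z) = of_real (1 - a) * (1 - h z)"
      using nz[OF z] by (simp add: h_def field_simps)
    from arg_cong[OF this, of cmod]
    have "cmod (1 - g z) * cmod (1 + of_real a * h z) = (1 - a) * cmod (1 - h z)"
      unfolding norm_mult norm_of_real using a1' by simp
    also have "\<dots> \<le> (1 - a) * 2"
      using h1[OF z] a1' norm_triangle_ineq4[of 1 "h z"] by (intro mult_left_mono) auto
    finally have 1: "cmod (1 - g z) * cmod (1 + of_real a * h z) \<le> 2 * (1 - a)" by simp
    have "cmod (of_real a * h z) \<le> cmod z"
      using mult_mono[of a 1 "cmod (h z)" "cmod z"] a a1 hz by (simp add: norm_mult)
    hence "1 - cmod z \<le> cmod (1 + of_real a * h z)"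
      using norm_triangle_ineq4[of "1 + of_real a * h z" "of_real a * h z"] by simp
    hence "cmod (1 - g z) * (1 - cmod z) \<le> cmod (1 - g z) * cmod (1 + of_real a * h z)"
      by (intro mult_left_mono) auto
    with 1 have "cmod (1 - g z) * (1 - cmod z) \<le> 2 * (1 - a)" by linarith
    hence 2: "cmod (1 - g z) \<le> 2 * (1 - a) / (1 - cmod z)" using z by (simp add: field_simps)
    have "\<phi> z - z = - z * (1 - g z)" by (cases "z = 0") (auto simp: g_def assms(3) field_simps)
    hence "cmod (\<phi> z - z) = cmod z * cmod (1 - g z)" by (simp add: norm_mult)
    also have "\<dots> \<le> 1 * cmod (1 - g z)" using z by (intro mult_right_mono) auto
    finally show ?thesis using 2 by simp
  qed
qed

text \<open>By the chain rule the derivative of \<phi> at 0 is a / b. The distance to the identity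
  is thus governed by the growth of a single coefficient, which is differentiable in time for the
  families considered.\<close>

lemma subordinate_near_identity:
  assumes f: "f holomorphic_on ball 0 1" "deriv f 0 = of_real a" "a > 0"
    and g: "g holomorphic_on ball 0 1" "deriv g 0 = of_real b" "b > 0"
    and "subordinate f g"
  obtains \<phi> where "\<phi> holomorphic_on ball 0 1" "\<phi> ` ball 0 1 \<subseteq> ball 0 1"
    "\<And>z. z \<in> ball 0 1 \<Longrightarrow> f z = g (\<phi> z)"
    "\<And>z. z \<in> ball 0 1 \<Longrightarrow> cmod (\<phi> z - z) \<le> 2 * (b - a) / (b * (1 - cmod z))"
proof -
  obtain \<phi> where \<phi>: "\<phi> holomorphic_on ball 0 1" "\<phi> ` ball 0 1 \<subseteq> ball 0 1" "\<phi> 0 = 0"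
     "\<And>z. z \<in> ball 0 1 \<Longrightarrow> f z = g (\<phi> z)"
    using assms(7) unfolding subordinate_def by blast
  have "(\<phi> has_field_derivative deriv \<phi> 0) (at 0)" "(g has_field_derivative deriv g 0) (at (\<phi> 0))"
    using holomorphic_derivI[OF \<phi>(1) open_ball, of 0] holomorphic_derivI[OF g(1) open_ball, of 0] \<phi>(3)
    by simp_all
  hence "((\<lambda>z. g (\<phi> z)) has_field_derivative deriv g 0 * deriv \<phi> 0) (at 0)"
    using DERIV_chain2 by blast
  hence "(f has_field_derivative deriv g 0 * deriv \<phi> 0) (at 0)"
    by (rule has_field_derivative_transform_within_open[of _ _ _ "ball 0 1"]) (auto simp: \<phi>)
  hence "of_real a = of_real b * deriv \<phi> 0" using f(2) g(2) DERIV_imp_deriv by force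
  hence d: "deriv \<phi> 0 = of_real (a / b)" using g(3) by (simp add: field_simps)
  have "cmod (\<phi> z - z) \<le> 2 * (b - a) / (b * (1 - cmod z))" if "z \<in> ball 0 1" for z
  proof -
    have "cmod (\<phi> z - z) \<le> 2 * (1 - a / b) / (1 - cmod z)"
      using that f(3) g(3) by (intro Schwarz_near_identity[OF \<phi>(1,2,3) d]) auto
    also have "\<dots> = 2 * (b - a) / (b * (1 - cmod z))"
      using g(3) by (simp add: field_simps)
    finally show ?thesis .
  qed
  thus ?thesis using that \<phi> by blast
qed

text \<open>A solution of \<phi> z = w is a fixed point of z \<mapsto> w - (\<phi> z - z), which
  maps the ball into itself; Brouwer's theorem applies.\<close>

lemma perturbed_identity_hits:
  fixes \<phi> :: "complex \<Rightarrow> complex"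
  assumes "continuous_on (cball w e) \<phi>" "e > 0" "\<And>z. z \<in> cball w e \<Longrightarrow> cmod (\<phi> z - z) \<le> e"
  obtains z where "z \<in> cball w e" "\<phi> z = w"
proof -
  have "continuous_on (cball w e) (\<lambda>z. w - (\<phi> z - z))"
    by (intro continuous_intros assms)
  moreover have "(\<lambda>z. w - (\<phi> z - z)) \<in> cball w e \<rightarrow> cball w e"
    using assms(3) by (auto simp: dist_norm)
  ultimately obtain z where "z \<in> cball w e" "w - (\<phi> z - z) = z"
    by (rule brouwer_ball[OF assms(2)])
  thus ?thesis using that by (simp add: algebra_simps)
qed

text \<open>Along a subordination chain critical values persist: a preimage of the value at the
  critical point moves by \<open>O(t - t\<^sub>0)\<close>.\<close>

theorem (in C1_family) subordination_imp_critical_points_stationary: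
  assumes U: "U = ball 0 1"
    and norm: "\<And>t. t \<in> J \<Longrightarrow> deriv (F t) 0 \<in> \<real> \<and> Re (deriv (F t) 0) > 0"
    and sub: "\<And>s t. s \<in> J \<Longrightarrow> t \<in> J \<Longrightarrow> s \<le> t \<Longrightarrow> subordinate (F s) (F t)"
    and t0: "t0 \<in> J" and w: "w \<in> ball 0 1" and crit: "deriv (F t0) w = 0"
  shows "F' t0 w = 0"
proof -
  define a where "a = (\<lambda>t. Re (deriv (F t) 0))"
  have a: "deriv (F t) 0 = of_real (a t)" "a t > 0" if "t \<in> J" for t
    using norm[OF that] by (auto simp: a_def complex_is_Real_iff complex_eq_iff)
  have hol: "F t holomorphic_on ball 0 1" if "t \<in> J" for t
    using holomorphic[OF that] U by simp
  \<comment> \<open>A Lipschitz bound at \<open>t0\<close> for the first coefficient: the modulus of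
    its derivative, plus one for the remainder.\<close>
  define L where "L = 1 + cmod (deriv (F' t0) 0)"
  have L: "L \<ge> 1" by (simp add: L_def)
  have "((\<lambda>s. deriv (F s) 0) has_vector_derivative deriv (F' t0) 0) (at t0 within J)"
    using C1_family.vector_derivative[OF C1_family_deriv t0] U by simp
  then obtain d where d: "d > 0" "\<And>s. s \<in> J \<Longrightarrow> \<bar>s - t0\<bar> < d \<Longrightarrow>
      cmod (deriv (F s) 0 - deriv (F t0) 0 - (s - t0) *\<^sub>R deriv (F' t0) 0) \<le> \<bar>s - t0\<bar>"
    unfolding has_vector_derivative_def has_derivative_within_alt
    by (metis mult_1 real_norm_def zero_less_one)
  have Lip: "\<bar>a s - a t0\<bar> \<le> L * \<bar>s - t0\<bar>" if "s \<in> J" "\<bar>s - t0\<bar> < d" for s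
  proof -
    have "\<bar>a s - a t0\<bar> = cmod (deriv (F s) 0 - deriv (F t0) 0)"
      using a[OF that(1)] a[OF t0] by (simp flip: of_real_diff)
    also have "\<dots> \<le> \<bar>s - t0\<bar> + cmod ((s - t0) *\<^sub>R deriv (F' t0) 0)"
      using d(2)[OF that] norm_triangle_ineq2[of "deriv (F s) 0 - deriv (F t0) 0" "(s - t0) *\<^sub>R deriv (F' t0) 0"]
      by linarith
    also have "\<dots> = L * \<bar>s - t0\<bar>" by (simp add: L_def distrib_right)
    finally show ?thesis .
  qed
  define \<eta> where "\<eta> = (1 - cmod w) / 2"
  have \<eta>: "\<eta> > 0" using w by (simp add: \<eta>_def)
  \<comment> \<open>This is 2 L divided by (\<open>a t0\<close> / 2) \<eta>, the lower bound for the
    denominator once \<open>a s\<close> is at least half of \<open>a t0\<close> and z is at distance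
    at least \<eta> from the circle.\<close>
  define C where "C = 4 * L / (a t0 * \<eta>)"
  have C: "C > 0" using L \<eta> a[OF t0] by (simp add: C_def)
  \<comment> \<open>The three bounds guarantee, in turn, the Lipschitz estimate, \<open>a s\<close>
    \<ge> \<open>a t0\<close> / 2, and a displacement of at most \<eta>.\<close>
  define \<delta> where "\<delta> = Min {d, a t0 / (2 * L), \<eta> / C}"
  have \<delta>: "\<delta> > 0" "\<delta> \<le> d" "\<delta> \<le> a t0 / (2 * L)" "\<delta> \<le> \<eta> / C"
    using d L \<eta> C a[OF t0] by (auto simp: \<delta>_def)
  have key: "\<exists>v\<in>ball 0 1. F s v = F t0 w \<and> cmod (v - w) \<le> C * \<bar>s - t0\<bar>"
    if s: "s \<in> J" "s \<noteq> t0" "\<bar>s - t0\<bar> < \<delta>" for s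
  proof -
    have lip: "\<bar>a s - a t0\<bar> \<le> L * \<bar>s - t0\<bar>" using Lip s \<delta> by simp
    have "L * \<bar>s - t0\<bar> \<le> L * (a t0 / (2 * L))" using s \<delta> L by (intro mult_left_mono) auto
    hence "L * \<bar>s - t0\<bar> \<le> a t0 / 2" using L by simp
    hence as: "a s \<ge> a t0 / 2" using lip by linarith
    have bound: "2 * x / (b * (1 - cmod z)) \<le> C * \<bar>s - t0\<bar>"
      if "b \<ge> a t0 / 2" "cmod z \<le> 1 - \<eta>" "x \<le> L * \<bar>s - t0\<bar>" for b z x
    proof -
      have "2 * x / (b * (1 - cmod z)) \<le> 2 * (L * \<bar>s - t0\<bar>) / (b * (1 - cmod z))"
        using that a[OF t0] \<eta> by (intro divide_right_mono) auto
      also have "\<dots> \<le> 2 * (L * \<bar>s - t0\<bar>) / (a t0 / 2 * \<eta>)"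
        using that a[OF t0] \<eta> L by (intro divide_left_mono mult_mono mult_pos_pos) auto
      also have "\<dots> = C * \<bar>s - t0\<bar>" by (simp add: C_def)
      finally show ?thesis .
    qed
    show ?thesis
    \<comment> \<open>For later times \<phi> w is the required preimage. For earlier times \<phi>
      points the other way, and w must be shown to lie in its range.\<close>
    proof (cases "t0 \<le> s")
      case True
      obtain \<phi> where \<phi>: "\<phi> ` ball 0 1 \<subseteq> ball 0 1" "\<And>z. z \<in> ball 0 1 \<Longrightarrow> F t0 z = F s (\<phi> z)"
         "\<And>z. z \<in> ball 0 1 \<Longrightarrow> cmod (\<phi> z - z) \<le> 2 * (a s - a t0) / (a s * (1 - cmod z))"
        using subordinate_near_identity[OF hol[OF t0] a[OF t0] hol[OF s(1)] a[OF s(1)] sub[OF t0 s(1) True]] by metis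
      have "cmod (\<phi> w - w) \<le> C * \<bar>s - t0\<bar>"
        using w as lip \<eta> by (intro order.trans[OF \<phi>(3)[OF w] bound]) (auto simp: \<eta>_def field_simps)
      moreover have "\<phi> w \<in> ball 0 1" using \<phi>(1) w by blast
      ultimately show ?thesis using \<phi>(2)[OF w] by metis
    next
      case False
      hence "s \<le> t0" by simp
      from sub[OF s(1) t0 this]
      obtain \<phi> where \<phi>: "\<phi> holomorphic_on ball 0 1" "\<And>z. z \<in> ball 0 1 \<Longrightarrow> F s z = F t0 (\<phi> z)"
         "\<And>z. z \<in> ball 0 1 \<Longrightarrow> cmod (\<phi> z - z) \<le> 2 * (a t0 - a s) / (a t0 * (1 - cmod z))"
        using subordinate_near_identity[OF hol[OF s(1)] a[OF s(1)] hol[OF t0] a[OF t0]] by metis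
      define e where "e = C * \<bar>s - t0\<bar>"
      have e: "e > 0" using C s by (simp add: e_def)
      have "e \<le> C * (\<eta> / C)" unfolding e_def using s \<delta> C by (intro mult_left_mono) auto
      hence "e \<le> \<eta>" using C by simp
      have z: "cmod z \<le> 1 - \<eta>" if "z \<in> cball w e" for z
      proof -
        have "cmod z \<le> cmod w + cmod (z - w)" using norm_triangle_ineq[of w "z - w"] by simp
        also have "cmod (z - w) \<le> e" using that by (simp add: dist_norm norm_minus_commute)
        finally show ?thesis using \<open>e \<le> \<eta>\<close> by (simp add: \<eta>_def field_simps)
      qed
      have sb: "cball w e \<subseteq> ball 0 1" using z \<eta> by force
      have "continuous_on (cball w e) \<phi>"
        using \<phi>(1) sb holomorphic_on_imp_continuous_on holomorphic_on_subset by blast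
      moreover have "cmod (\<phi> z - z) \<le> e" if "z \<in> cball w e" for z
        unfolding e_def using that sb lip a[OF t0] z
        by (intro order.trans[OF \<phi>(3) bound]) auto
      ultimately obtain v where v: "v \<in> cball w e" "\<phi> v = w"
        using perturbed_identity_hits[OF _ e] by metis
      thus ?thesis using \<phi>(2)[of v] sb by (intro bexI[of _ v]) (auto simp: e_def dist_norm norm_minus_commute)
    qed
  qed
  obtain s where s: "\<And>n. s n \<in> J - {t0}" "s \<longlonglongrightarrow> t0"
    using islimpt_J[OF t0] unfolding islimpt_sequential by blast
  obtain N where N: "\<And>n. n \<ge> N \<Longrightarrow> dist (s n) t0 < \<delta>"
    using tendstoD[OF s(2) \<delta>(1)] unfolding eventually_sequentially by blast
  define s' where "s' = (\<lambda>n. s (n + N))"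
  have s': "s' n \<in> J" "s' n \<noteq> t0" "\<bar>s' n - t0\<bar> < \<delta>" for n
    using s(1)[of "n + N"] N[of "n + N"] by (auto simp: s'_def dist_real_def)
  have lim: "s' \<longlonglongrightarrow> t0" unfolding s'_def by (rule LIMSEQ_ignore_initial_segment[OF s(2)])
  obtain v where v: "\<And>n. v n \<in> ball 0 1" "\<And>n. F (s' n) (v n) = F t0 w" "\<And>n. cmod (v n - w) \<le> C * \<bar>s' n - t0\<bar>"
    using key[OF s'] by metis
  show ?thesis
    by (rule time_derivative_zero_at_critical_point[of t0 w s' v C])
      (use t0 w U crit s' lim v in auto)
qed

subsection \<open>The flow of a Herglotz vector field\<close>

text \<open>Moves the endpoint t into the integrand over a fixed interval, so that continuity in t
  becomes continuity in a parameter.\<close>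

lemma integral_unit_interval:
  fixes g :: "real \<Rightarrow> complex"
  assumes "continuous_on {a..t} g" "a \<le> t"
  shows "integral {a..t} g = of_real (t - a) * integral {0..1} (\<lambda>x. g (a + (t - a) * x))"
proof (cases "a = t")
  case False
  hence "t - a > 0" using assms by simp
  have "(g has_integral integral {a..t} g) (cbox a t)"
    using assms(1) by (auto intro: integrable_integral integrable_continuous_real)
  from has_integral_affinity'[OF this \<open>t - a > 0\<close>, of a] \<open>t - a > 0\<close>
  have "((\<lambda>x. g (a + (t - a) * x)) has_integral integral {a..t} g /\<^sub>R (t - a)) {0..1}"
    by (simp add: add.commute)
  hence "integral {0..1} (\<lambda>x. g (a + (t - a) * x)) = integral {a..t} g /\<^sub>R (t - a)"
    by (rule integral_unique)
  thus ?thesis using \<open>t - a > 0\<close> by (simp add: scaleR_conv_of_real field_simps flip: of_real_diff)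
qed simp

lemma continuous_on_integral_upto:
  fixes G :: "real \<Rightarrow> 'z::topological_space \<Rightarrow> complex"
  assumes "continuous_on ({a..b} \<times> U) (\<lambda>(s, z). G s z)"
  shows "continuous_on ({a..b} \<times> U) (\<lambda>(t, z). integral {a..t} (\<lambda>s. G s z))"
proof -
  have in_ab: "a + (t - a) * x \<in> {a..b}" if "t \<in> {a..b}" "x \<in> {0..1}" for t x :: real
  proof -
    have "(t - a) * x \<le> (t - a) * 1" using that by (intro mult_left_mono) auto
    thus ?thesis using that by auto
  qed
  have "continuous_on (({a..b} \<times> U) \<times> cbox 0 1) (\<lambda>(p, x). G (a + (fst p - a) * x) (snd p))"
    unfolding split_beta
    by (intro continuous_on_compose2[OF assms, where f = "\<lambda>p. (a + (fst (fst p) - a) * snd p, snd (fst p))", simplified split_beta fst_conv snd_conv] continuous_intros)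
      (use in_ab in auto)
  from integral_continuous_on_param[OF this]
  have "continuous_on ({a..b} \<times> U) (\<lambda>p. of_real (fst p - a) * integral {0..1} (\<lambda>x. G (a + (fst p - a) * x) (snd p)))"
    by (intro continuous_intros) auto
  moreover have "of_real (fst p - a) * integral {0..1} (\<lambda>x. G (a + (fst p - a) * x) (snd p)) =
      (\<lambda>(t, z). integral {a..t} (\<lambda>s. G s z)) p" if "p \<in> {a..b} \<times> U" for p
  proof -
    have "continuous_on {a..fst p} (\<lambda>s. G s (snd p))"
      using that by (intro continuous_on_compose2[OF assms, where f = "\<lambda>s. (s, snd p)", simplified split_beta fst_conv snd_conv] continuous_intros) auto
    from integral_unit_interval[OF this] that show ?thesis by (auto simp: split_beta)
  qed
  ultimately show ?thesis by (rule continuous_on_eq)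
qed

lemma holomorphic_on_integral_upto:
  fixes G :: "real \<Rightarrow> complex \<Rightarrow> complex"
  assumes "continuous_on ({a..b} \<times> U) (\<lambda>(s, z). G s z)" "\<And>s. s \<in> {a..b} \<Longrightarrow> G s holomorphic_on U"
    "open U" "convex U" "t \<in> {a..b}"
  shows "(\<lambda>z. integral {a..t} (\<lambda>s. G s z)) holomorphic_on U"
proof -
  have "continuous_on ({a..b} \<times> U) (\<lambda>(s, z). deriv (G s) z)"
    by (intro continuous_on_deriv_family assms)
  moreover have "continuous_on (U \<times> cbox a t) prod.swap"
    by (rule continuous_on_swap)
  moreover have "prod.swap ` (U \<times> cbox a t) \<subseteq> {a..b} \<times> U" using assms(5) by auto
  ultimately have "continuous_on (U \<times> cbox a t) (\<lambda>p. (\<lambda>(s, z). deriv (G s) z) (prod.swap p))"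
    by (rule continuous_on_compose2)
  hence d: "continuous_on (U \<times> cbox a t) (\<lambda>(z, s). deriv (G s) z)"
    by (simp add: case_prod_unfold)
  have "(\<lambda>z. integral (cbox a t) (\<lambda>s. G s z)) holomorphic_on U"
  proof (rule leibniz_rule_holomorphic[OF _ _ d assms(4)])
    show "((\<lambda>z. G s z) has_field_derivative deriv (G s) z) (at z within U)" if "z \<in> U" "s \<in> cbox a t" for z s
    proof -
      have "s \<in> {a..b}" using that(2) assms(5) by auto
      from holomorphic_derivI[OF assms(2)[OF this] assms(3) that(1)]
      show ?thesis by (rule has_field_derivative_at_within)
    qed
    show "(\<lambda>s. G s z) integrable_on cbox a t" if "z \<in> U" for z
      using that assms(5)
      by (intro integrable_continuous continuous_on_compose2[OF assms(1), where f = "\<lambda>s. (s, z)", simplified split_beta fst_conv snd_conv] continuous_intros) auto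
  qed
  thus ?thesis by simp
qed

text \<open>On the right half plane, which is convex, the derivative of exp (- z) has modulus at
  most one.\<close>

lemma norm_exp_uminus_diff_le:
  assumes "Re A \<ge> 0" "Re B \<ge> 0"
  shows "cmod (exp (- A) - exp (- B)) \<le> cmod (A - B)"
proof -
  have "convex {z. Re z \<ge> 0}" by (rule convex_halfspace_Re_ge)
  hence "cmod (exp (- A) - exp (- B)) \<le> 1 * cmod (A - B)"
    by (rule field_differentiable_bound[of _ _ "\<lambda>z. - exp (- z)"])
      (use assms in \<open>auto intro!: derivative_eq_intros\<close>)
  thus ?thesis by simp
qed

lemma Lipschitz_on_disc:
  fixes P :: "real \<Rightarrow> complex \<Rightarrow> complex"
  assumes "continuous_on ({a..b} \<times> ball 0 1) (\<lambda>(t, z). P t z)" "\<And>t. t \<in> {a..b} \<Longrightarrow> P t holomorphic_on ball 0 1"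
    "r < 1"
  shows "\<exists>L>0. \<forall>t\<in>{a..b}. \<forall>z\<in>cball 0 r. \<forall>w\<in>cball 0 r. cmod (P t z - P t w) \<le> L * cmod (z - w)"
proof -
  have sub: "cball 0 r \<subseteq> ball (0::complex) 1" using assms(3) by auto
  have "continuous_on ({a..b} \<times> ball 0 1) (\<lambda>(s, z). deriv (P s) z)"
    by (intro continuous_on_deriv_family assms) auto
  hence "continuous_on ({a..b} \<times> cball 0 r) (\<lambda>(s, z). deriv (P s) z)"
    by (rule continuous_on_subset) (use sub in auto)
  hence "bounded ((\<lambda>(s, z). deriv (P s) z) ` ({a..b} \<times> cball 0 r))"
    by (intro compact_imp_bounded compact_continuous_image compact_Times) auto
  then obtain L where L: "L > 0" "\<forall>x\<in>(\<lambda>(s, z). deriv (P s) z) ` ({a..b} \<times> cball 0 r). cmod x \<le> L"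
    unfolding bounded_pos by blast
  have "cmod (P t z - P t w) \<le> L * cmod (z - w)" if "t \<in> {a..b}" "z \<in> cball 0 r" "w \<in> cball 0 r" for t z w
  proof (rule field_differentiable_bound[OF convex_cball _ _ that(2,3)])
    show "(P t has_field_derivative deriv (P t) u) (at u within cball 0 r)" if "u \<in> cball 0 r" for u
    proof -
      have "u \<in> ball 0 1" using that sub by blast
      from holomorphic_derivI[OF assms(2)[OF \<open>t \<in> {a..b}\<close>] open_ball this]
      show ?thesis by (rule has_field_derivative_at_within)
    qed
    show "cmod (deriv (P t) u) \<le> L" if "u \<in> cball 0 r" for u
      using L(2) that \<open>t \<in> {a..b}\<close> by auto
  qed
  thus ?thesis using L(1) by blast
qed

section \<open>Picard iteration and the flow of the characteristic equation\<close>

locale herglotz_field =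
  fixes a b :: real and P :: "real \<Rightarrow> complex \<Rightarrow> complex"
  assumes cont_P: "continuous_on ({a..b} \<times> ball 0 1) (\<lambda>(t, z). P t z)"
    and hol_P: "\<And>t. t \<in> {a..b} \<Longrightarrow> P t holomorphic_on ball 0 1"
    and Re_P: "\<And>t z. t \<in> {a..b} \<Longrightarrow> z \<in> ball 0 1 \<Longrightarrow> Re (P t z) \<ge> 0"
begin

text \<open>Writing the equation \<open>w' = - w P(t, w)\<close> as \<open>w = z exp (- \<integral> P(s, w) ds)\<close> keeps all Picard iterates
  in the disc of radius \<open>|z|\<close>, so that the iteration converges on the whole time interval.\<close>

primrec picard :: "nat \<Rightarrow> real \<Rightarrow> complex \<Rightarrow> complex" where
  "picard 0 t z = z"
| "picard (Suc n) t z = z * exp (- integral {a..t} (\<lambda>s. P s (picard n s z)))"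

lemma Re_integral_nonneg:
  assumes "t \<in> {a..b}" "\<And>s. s \<in> {a..b} \<Longrightarrow> w s \<in> ball 0 1" "continuous_on {a..b} w"
  shows "(\<lambda>s. P s (w s)) integrable_on {a..t}" "Re (integral {a..t} (\<lambda>s. P s (w s))) \<ge> 0"
proof -
  have "continuous_on {a..t} (\<lambda>s. P s (w s))"
    using assms by (intro continuous_on_compose2[OF cont_P, where f = "\<lambda>s. (s, w s)", simplified split_beta fst_conv snd_conv]
       continuous_intros continuous_on_subset[OF assms(3)]) auto
  thus i: "(\<lambda>s. P s (w s)) integrable_on {a..t}" by (rule integrable_continuous_real)
  have "Re (integral {a..t} (\<lambda>s. P s (w s))) = integral {a..t} (\<lambda>s. Re (P s (w s)))"
    using integral_linear[OF i bounded_linear_Re] by (simp add: o_def)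
  also have "\<dots> \<ge> 0" using assms Re_P by (intro integral_nonneg integrable_linear[OF i bounded_linear_Re, unfolded o_def]) auto
  finally show "Re (integral {a..t} (\<lambda>s. P s (w s))) \<ge> 0" .
qed

lemma norm_exp_integral_le:
  assumes "t \<in> {a..b}" "\<And>s. s \<in> {a..b} \<Longrightarrow> w s \<in> ball 0 1" "continuous_on {a..b} w"
  shows "cmod (z * exp (- integral {a..t} (\<lambda>s. P s (w s)))) \<le> cmod z"
  using Re_integral_nonneg(2)[OF assms] mult_left_mono[of "exp (- Re (integral {a..t} (\<lambda>s. P s (w s))))" 1 "cmod z"]
  by (simp add: norm_mult)

lemma picard:
  shows "continuous_on ({a..b} \<times> ball 0 1) (\<lambda>(t, z). picard n t z)"
    and "\<And>t. t \<in> {a..b} \<Longrightarrow> picard n t holomorphic_on ball 0 1"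
    and "\<And>t z. t \<in> {a..b} \<Longrightarrow> z \<in> ball 0 1 \<Longrightarrow> cmod (picard n t z) \<le> cmod z"
proof (induction n)
  case 0
  {
    case 1 show ?case by (auto simp: split_beta intro!: continuous_intros)
  next
    case (2 t) show ?case by (simp add: holomorphic_on_ident[unfolded id_def])
  next
    case 3 show ?case by simp
  }
next
  case (Suc n)
  have in_ball: "picard n t z \<in> ball 0 1" if "t \<in> {a..b}" "z \<in> ball 0 1" for t z
    using Suc(3)[OF that] that by simp
  have cP: "continuous_on ({a..b} \<times> ball 0 1) (\<lambda>(s, z). P s (picard n s z))"
    unfolding split_beta using in_ball
    by (intro continuous_on_compose2[OF cont_P, where f = "\<lambda>p. (fst p, picard n (fst p) (snd p))", simplified split_beta fst_conv snd_conv]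
      continuous_intros Suc(1)[unfolded split_beta]) auto
  have hP: "(\<lambda>z. P s (picard n s z)) holomorphic_on ball 0 1" if "s \<in> {a..b}" for s
  proof -
    have "picard n s ` ball 0 1 \<subseteq> ball 0 1" using in_ball[OF that] by blast
    from holomorphic_on_compose_gen[OF Suc(2)[OF that] hol_P[OF that] this] show ?thesis by (simp add: o_def)
  qed
  {
    case 1
    show ?case using continuous_on_integral_upto[OF cP] by (auto simp: split_beta intro!: continuous_intros)
  next
    case (2 t)
    have "(\<lambda>z. z * exp (- integral {a..t} (\<lambda>s. P s (picard n s z)))) holomorphic_on ball 0 1"
      by (intro holomorphic_intros holomorphic_on_integral_upto[OF cP hP] 2) auto
    thus ?case by (simp cong: holomorphic_cong)
  next
    case (3 t z)
    have "continuous_on {a..b} (\<lambda>s. picard n s z)"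
      using 3(2) by (intro continuous_on_compose2[OF Suc(1), where f = "\<lambda>s. (s, z)", simplified split_beta fst_conv snd_conv] continuous_intros) auto
    from norm_exp_integral_le[OF 3(1) in_ball[OF _ 3(2)] this] show ?case by simp
  }
qed

lemma continuous_on_picard:
  assumes "z \<in> ball 0 1"
  shows "continuous_on {a..b} (\<lambda>s. picard n s z)"
  using assms by (intro continuous_on_compose2[OF picard(1), where f = "\<lambda>s. (s, z)", simplified split_beta fst_conv snd_conv] continuous_intros) auto

lemma picard_in_ball: "t \<in> {a..b} \<Longrightarrow> z \<in> ball 0 1 \<Longrightarrow> picard n t z \<in> ball 0 1"
  using picard(3)[of t z n] by simp

text \<open>The antiderivative gains a factor 1 / (2 L) against the Lipschitz constant L; this is
  the halving in each Picard step.\<close>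

lemma integral_exp_le:
  assumes "L > 0" "a \<le> t"
  shows "((\<lambda>s. L * exp (2 * L * (s - a))) has_integral (exp (2 * L * (t - a)) - 1) / 2) {a..t}"
proof -
  have "((\<lambda>s. exp (2 * L * (s - a)) / 2) has_vector_derivative L * exp (2 * L * (s - a))) (at s within {a..t})" for s
    by (auto intro!: derivative_eq_intros simp flip: has_real_derivative_iff_has_vector_derivative)
  from fundamental_theorem_of_calculus[OF assms(2) this] show ?thesis
    by (simp add: diff_divide_distrib)
qed

text \<open>The weight \<open>exp (2 L (t - a))\<close> makes the Picard iteration a contraction.\<close>

lemma picard_step:
  assumes "L > 0" and L: "\<forall>t\<in>{a..b}. \<forall>z\<in>cball 0 r. \<forall>w\<in>cball 0 r. cmod (P t z - P t w) \<le> L * cmod (z - w)"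
    and "r < 1" "z \<in> cball 0 r" "t \<in> {a..b}"
  shows "cmod (picard (Suc n) t z - picard n t z) \<le> 2 * (1 / 2) ^ n * exp (2 * L * (t - a))"
  using assms(5)
proof (induction n arbitrary: t)
  case 0
  have z: "z \<in> ball 0 1" using assms by auto
  have "cmod (picard (Suc 0) t z - picard 0 t z) \<le> cmod (picard (Suc 0) t z) + cmod (picard 0 t z)"
    by (rule norm_triangle_ineq4)
  also have "\<dots> \<le> 2 * 1" using picard(3)[OF 0 z, of "Suc 0"] picard(3)[OF 0 z, of 0] z by simp
  also have "\<dots> \<le> 2 * exp (2 * L * (t - a))" using assms 0 by (intro mult_left_mono) auto
  finally show ?case by simp
next
  case (Suc n)
  have z: "z \<in> ball 0 1" using assms by auto
  have in_r: "picard k s z \<in> cball 0 r" if "s \<in> {a..b}" for k s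
    using picard(3)[OF that z, of k] assms(4) by simp
  note int = Re_integral_nonneg[OF Suc.prems picard_in_ball[OF _ z] continuous_on_picard[OF z]]
  let ?I = "\<lambda>k. integral {a..t} (\<lambda>s. P s (picard k s z))"
  have "cmod (picard (Suc (Suc n)) t z - picard (Suc n) t z) = cmod z * cmod (exp (- ?I (Suc n)) - exp (- ?I n))"
    by (simp only: picard.simps norm_mult flip: right_diff_distrib)
  also have "\<dots> \<le> 1 * cmod (?I (Suc n) - ?I n)"
    using z by (intro mult_mono norm_exp_uminus_diff_le int) auto
  also have "?I (Suc n) - ?I n = integral {a..t} (\<lambda>s. P s (picard (Suc n) s z) - P s (picard n s z))"
    by (intro integral_diff[symmetric] int)
  also have "1 * cmod \<dots> \<le> integral {a..t} (\<lambda>s. 2 * (1 / 2) ^ n * (L * exp (2 * L * (s - a))))"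
    unfolding mult_1
  proof (intro integral_norm_bound_integral integrable_diff int)
    fix s assume "s \<in> {a..t}"
    hence s: "s \<in> {a..b}" using Suc.prems by auto
    have "cmod (P s (picard (Suc n) s z) - P s (picard n s z)) \<le> L * cmod (picard (Suc n) s z - picard n s z)"
      using L s in_r[OF s] by blast
    also have "\<dots> \<le> L * (2 * (1 / 2) ^ n * exp (2 * L * (s - a)))"
      using Suc.IH[OF s] assms(1) by (intro mult_left_mono) auto
    finally show "cmod (P s (picard (Suc n) s z) - P s (picard n s z)) \<le> 2 * (1 / 2) ^ n * (L * exp (2 * L * (s - a)))"
      by (simp add: mult_ac)
  qed (use Suc.prems in \<open>auto intro!: integrable_continuous_real continuous_intros\<close>)
  also have "\<dots> = 2 * (1 / 2) ^ n * ((exp (2 * L * (t - a)) - 1) / 2)"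
    by (rule integral_unique[OF has_integral_mult_right[OF integral_exp_le[OF assms(1)]]]) (use Suc.prems in simp)
  also have "\<dots> \<le> 2 * (1 / 2) ^ n * (exp (2 * L * (t - a)) / 2)"
    by (intro mult_left_mono) auto
  finally show ?case by (simp add: mult_ac)
qed

text \<open>The limit of the iterates as a telescoping series, a form in which the Weierstrass test
  yields existence of the limit and uniform convergence together.\<close>

definition flow :: "real \<Rightarrow> complex \<Rightarrow> complex" where
  "flow t z = z + (\<Sum>n. picard (Suc n) t z - picard n t z)"

lemma picard_uniform_limit:
  assumes "r < 1"
  shows "uniform_limit ({a..b} \<times> cball 0 r) (\<lambda>n (t, z). picard n t z) (\<lambda>(t, z). flow t z) sequentially"
proof -
  obtain L where L: "L > 0" "\<forall>t\<in>{a..b}. \<forall>z\<in>cball 0 r. \<forall>w\<in>cball 0 r. cmod (P t z - P t w) \<le> L * cmod (z - w)"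
    using Lipschitz_on_disc[OF cont_P hol_P assms] by blast
  have "uniform_limit ({a..b} \<times> cball 0 r) (\<lambda>n p. \<Sum>i<n. picard (Suc i) (fst p) (snd p) - picard i (fst p) (snd p))
     (\<lambda>p. \<Sum>i. picard (Suc i) (fst p) (snd p) - picard i (fst p) (snd p)) sequentially"
  proof (rule Weierstrass_m_test)
    show "norm (picard (Suc n) (fst p) (snd p) - picard n (fst p) (snd p)) \<le> 2 * exp (2 * L * (b - a)) * (1 / 2) ^ n"
      if "p \<in> {a..b} \<times> cball 0 r" for n p
    proof -
      have "norm (picard (Suc n) (fst p) (snd p) - picard n (fst p) (snd p)) \<le> 2 * (1 / 2) ^ n * exp (2 * L * (fst p - a))"
        using that by (intro picard_step[OF L assms]) auto
      also have "\<dots> \<le> 2 * (1 / 2) ^ n * exp (2 * L * (b - a))"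
        using that L(1) by (intro mult_left_mono) auto
      finally show ?thesis by (simp add: mult_ac)
    qed
    show "summable (\<lambda>n. 2 * exp (2 * L * (b - a)) * (1 / 2) ^ n)"
      by (intro summable_mult summable_geometric) auto
  qed
  from uniform_limit_add[OF uniform_limit_const[where c = snd] this]
  have "uniform_limit ({a..b} \<times> cball 0 r)
     (\<lambda>n p. snd p + (\<Sum>i<n. picard (Suc i) (fst p) (snd p) - picard i (fst p) (snd p)))
     (\<lambda>p. flow (fst p) (snd p)) sequentially"
    by (simp add: flow_def del: picard.simps)
  moreover have "snd p + (\<Sum>i<n. picard (Suc i) (fst p) (snd p) - picard i (fst p) (snd p)) =
      picard n (fst p) (snd p)" for n p
    using sum_lessThan_telescope[of "\<lambda>k. picard k (fst p) (snd p)" n]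
    by (simp only: picard.simps(1)) simp
  ultimately show ?thesis by (simp add: case_prod_unfold)
qed

lemma picard_tendsto:
  assumes "t \<in> {a..b}" "z \<in> ball 0 1"
  shows "(\<lambda>n. picard n t z) \<longlonglongrightarrow> flow t z"
  using tendsto_uniform_limitI[OF picard_uniform_limit[of "cmod z"], of "(t, z)"] assms by simp

lemma norm_flow_le:
  assumes "t \<in> {a..b}" "z \<in> ball 0 1"
  shows "cmod (flow t z) \<le> cmod z"
  by (rule tendsto_upperbound[OF tendsto_norm[OF picard_tendsto[OF assms]]]) (use picard(3)[OF assms] in auto)

lemma flow_in_ball: "t \<in> {a..b} \<Longrightarrow> z \<in> ball 0 1 \<Longrightarrow> flow t z \<in> ball 0 1"
  using norm_flow_le[of t z] by simp

lemma uniform_limit_slice: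
  assumes "z \<in> ball 0 1"
  shows "uniform_limit {a..b} (\<lambda>n t. picard n t z) (\<lambda>t. flow t z) sequentially"
  using uniform_limit_compose'[OF picard_uniform_limit[of "cmod z"], of "\<lambda>t. (t, z)" "{a..b}"] assms by simp

lemma continuous_on_flow:
  assumes "z \<in> ball 0 1"
  shows "continuous_on {a..b} (\<lambda>t. flow t z)"
  by (rule uniform_limit_theorem[OF _ uniform_limit_slice[OF assms]]) (auto intro!: always_eventually continuous_on_picard[OF assms])

lemma holomorphic_on_flow:
  assumes "t \<in> {a..b}"
  shows "flow t holomorphic_on ball 0 1"
proof (rule holomorphic_uniform_sequence[OF open_ball picard(2)[OF assms]])
  fix z :: complex assume z: "z \<in> ball 0 1"
  define d where "d = (1 - cmod z) / 2"
  have d: "d > 0" using z by (simp add: d_def)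
  have sub: "cball z d \<subseteq> cball 0 (1 - d)"
  proof
    fix u assume "u \<in> cball z d"
    hence "cmod u \<le> cmod z + d"
      using norm_triangle_ineq[of z "u - z"] by (simp add: dist_norm norm_minus_commute)
    thus "u \<in> cball 0 (1 - d)" by (simp add: d_def field_simps)
  qed
  have "(\<lambda>u. (t, u)) \<in> cball z d \<rightarrow> {a..b} \<times> cball 0 (1 - d)" using sub assms by blast
  from uniform_limit_compose'[OF picard_uniform_limit[of "1 - d"] this] d
  have "uniform_limit (cball z d) (\<lambda>n. picard n t) (flow t) sequentially" by simp
  moreover have "cball z d \<subseteq> ball 0 1" using sub d by force
  ultimately show "\<exists>d>0. cball z d \<subseteq> ball 0 1 \<and> uniform_limit (cball z d) (\<lambda>n. picard n t) (flow t) sequentially"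
    using d by blast
qed

text \<open>All iterates stay in the closed disc of radius |z|, on which \<open>P\<close> is
  Lipschitz uniformly in time. Uniform convergence of the iterates thus carries over to the
  integrands.\<close>

lemma flow_integral_equation:
  assumes t: "t \<in> {a..b}" and z: "z \<in> ball 0 1"
  shows "flow t z = z * exp (- integral {a..t} (\<lambda>s. P s (flow s z)))"
proof -
  obtain L where L: "L > 0" "\<forall>t\<in>{a..b}. \<forall>u\<in>cball 0 (cmod z). \<forall>w\<in>cball 0 (cmod z). cmod (P t u - P t w) \<le> L * cmod (u - w)"
    using Lipschitz_on_disc[OF cont_P hol_P, of "cmod z"] z by auto
  have "uniform_limit {a..t} (\<lambda>n s. P s (picard n s z)) (\<lambda>s. P s (flow s z)) sequentially"
  proof (rule uniform_limitI)
    fix e :: real assume "e > 0"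
    have "\<forall>\<^sub>F n in sequentially. \<forall>s\<in>{a..b}. dist (picard n s z) (flow s z) < e / L"
      using L(1) \<open>e > 0\<close> by (intro uniform_limitD[OF uniform_limit_slice[OF z]]) auto
    thus "\<forall>\<^sub>F n in sequentially. \<forall>s\<in>{a..t}. dist (P s (picard n s z)) (P s (flow s z)) < e"
    proof eventually_elim
      case (elim n)
      show ?case
      proof
        fix s assume "s \<in> {a..t}"
        hence s: "s \<in> {a..b}" using t by auto
        have "dist (P s (picard n s z)) (P s (flow s z)) \<le> L * dist (picard n s z) (flow s z)"
          using L(2) s picard(3)[OF s z] norm_flow_le[OF s z] by (simp add: dist_norm)
        also have "\<dots> < L * (e / L)" using elim s L(1) by (intro mult_strict_left_mono) auto
        finally show "dist (P s (picard n s z)) (P s (flow s z)) < e" using L(1) by simp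
      qed
    qed
  qed
  moreover have "continuous_on {a..t} (\<lambda>s. P s (picard n s z))" for n
    using t z picard_in_ball by (intro continuous_on_compose2[OF cont_P, where f = "\<lambda>s. (s, picard n s z)", simplified split_beta fst_conv snd_conv]
       continuous_intros continuous_on_subset[OF continuous_on_picard[OF z]]) auto
  ultimately obtain I J where I: "\<And>n. ((\<lambda>s. P s (picard n s z)) has_integral I n) {a..t}"
      and J: "((\<lambda>s. P s (flow s z)) has_integral J) {a..t}" and IJ: "I \<longlonglongrightarrow> J"
    by (rule uniform_limit_integral) auto
  have "(\<lambda>n. integral {a..t} (\<lambda>s. P s (picard n s z))) \<longlonglongrightarrow> integral {a..t} (\<lambda>s. P s (flow s z))"
    using IJ unfolding integral_unique[OF I] integral_unique[OF J] .
  hence "(\<lambda>n. picard (Suc n) t z) \<longlonglongrightarrow> z * exp (- integral {a..t} (\<lambda>s. P s (flow s z)))"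
    unfolding picard.simps by (intro tendsto_intros)
  moreover have "(\<lambda>n. picard (Suc n) t z) \<longlonglongrightarrow> flow t z"
    by (rule LIMSEQ_Suc[OF picard_tendsto[OF t z]])
  ultimately show ?thesis by (metis LIMSEQ_unique)
qed

lemma flow_start: "a \<le> b \<Longrightarrow> z \<in> ball 0 1 \<Longrightarrow> flow a z = z"
  using flow_integral_equation[of a z] by simp

lemma flow_ode:
  assumes t: "t \<in> {a..b}" and z: "z \<in> ball 0 1"
  shows "((\<lambda>t. flow t z) has_vector_derivative - flow t z * P t (flow t z)) (at t within {a..b})"
proof -
  let ?I = "\<lambda>t. integral {a..t} (\<lambda>s. P s (flow s z))"
  have "continuous_on {a..b} (\<lambda>s. P s (flow s z))"
    using z flow_in_ball by (intro continuous_on_compose2[OF cont_P, where f = "\<lambda>s. (s, flow s z)", simplified split_beta fst_conv snd_conv]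
       continuous_intros continuous_on_flow) auto
  from integral_has_vector_derivative[OF this t]
  have "(?I has_vector_derivative P t (flow t z)) (at t within {a..b})" .
  moreover have "((\<lambda>I. z * exp (- I)) has_field_derivative - (z * exp (- ?I t))) (at (?I t) within ?I ` {a..b})"
    by (auto intro!: derivative_eq_intros)
  ultimately have "((\<lambda>I. z * exp (- I)) \<circ> ?I has_vector_derivative P t (flow t z) * - (z * exp (- ?I t))) (at t within {a..b})"
    by (rule field_vector_diff_chain_within)
  hence "((\<lambda>t. z * exp (- ?I t)) has_vector_derivative - flow t z * P t (flow t z)) (at t within {a..b})"
    by (simp add: o_def mult_ac flip: flow_integral_equation[OF t z])
  thus ?thesis
    by (rule has_vector_derivative_transform[OF t, rotated]) (rule flow_integral_equation[OF _ z])
qed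

text \<open>Backward uniqueness by a Gronwall argument: the difference u of two solutions satisfies
  |u'| \<le> M |u|, so exp (2 M t) |u|\<open>\<^sup>2\<close> cannot decrease. If it is zero at b,
  it is zero at a, where the flow is the identity.\<close>

lemma inj_on_flow:
  assumes "a \<le> b"
  shows "inj_on (flow b) (ball 0 1)"
proof (rule inj_onI)
  fix x y :: complex assume x: "x \<in> ball 0 1" and y: "y \<in> ball 0 1" and eq: "flow b x = flow b y"
  show "x = y"
  proof (cases "a = b")
    case True
    thus ?thesis using eq flow_start[OF _ x] flow_start[OF _ y] by simp
  next
    case False
    hence ab: "a < b" using assms by simp
    define r where "r = max (cmod x) (cmod y)"
    have "continuous_on ({a..b} \<times> ball 0 1) (\<lambda>(t, z). z * P t z)"
      using cont_P by (auto simp: split_beta intro!: continuous_intros)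
    moreover have "(\<lambda>z. z * P t z) holomorphic_on ball 0 1" if "t \<in> {a..b}" for t
      by (intro holomorphic_intros hol_P that)
    moreover have "r < 1" using x y by (simp add: r_def)
    ultimately obtain M where M: "M > 0" "\<forall>t\<in>{a..b}. \<forall>z\<in>cball 0 r. \<forall>w\<in>cball 0 r. cmod (z * P t z - w * P t w) \<le> M * cmod (z - w)"
      using Lipschitz_on_disc[of a b "\<lambda>t z. z * P t z" r] by blast
    define u where "u = (\<lambda>t. flow t x - flow t y)"
    define u' where "u' = (\<lambda>t. flow t y * P t (flow t y) - flow t x * P t (flow t x))"
    have du: "(u has_derivative (\<lambda>h. h *\<^sub>R u' t)) (at t within {a..b})" if "t \<in> {a..b}" for t
      using has_vector_derivative_diff[OF flow_ode[OF that x] flow_ode[OF that y]]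
      by (simp add: u_def u'_def has_vector_derivative_def)
    define G where "G = (\<lambda>t. exp (2 * M * t) * (u t \<bullet> u t))"
    have dG: "(G has_derivative (\<lambda>h. h * (exp (2 * M * t) * (2 * (u t \<bullet> u' t) + 2 * M * (u t \<bullet> u t))))) (at t within {a..b})"
      if "a \<le> t" "t \<le> b" for t
      unfolding G_def using that
      by (auto intro!: derivative_eq_intros du simp: algebra_simps inner_commute)
    obtain t where t: "t \<in> {a<..<b}" "G b - G a = (b - a) * (exp (2 * M * t) * (2 * (u t \<bullet> u' t) + 2 * M * (u t \<bullet> u t)))"
      using mvt_simple[OF ab dG] by auto
    have tab: "t \<in> {a..b}" using t by auto
    have "cmod (u' t) \<le> M * cmod (u t)"
      using M(2) tab norm_flow_le[OF tab x] norm_flow_le[OF tab y] 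
      by (auto simp: u_def u'_def r_def norm_minus_commute)
    hence "cmod (u t) * cmod (u' t) \<le> cmod (u t) * (M * cmod (u t))" by (intro mult_left_mono) auto
    also have "\<dots> = M * (u t \<bullet> u t)" by (simp add: dot_square_norm power2_eq_square)
    finally have "- (u t \<bullet> u' t) \<le> M * (u t \<bullet> u t)"
      using norm_cauchy_schwarz[of "- u t" "u' t"] by simp
    hence "G b - G a \<ge> 0" unfolding t(2) using ab by (intro mult_nonneg_nonneg) auto
    moreover have "G b = 0" using eq by (simp add: G_def u_def)
    ultimately have "exp (2 * M * a) * (u a \<bullet> u a) \<le> 0" by (simp add: G_def)
    hence "u a \<bullet> u a \<le> 0" by (simp add: mult_le_0_iff)
    hence "u a = 0" using inner_gt_zero_iff[of "u a"] by linarith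
    thus ?thesis using flow_start[OF assms] x y by (simp add: u_def)
  qed
qed

end

theorem (in C1_family) Loewner_Kufarev_imp_subordinate:
  assumes U: "U = ball 0 1" and ab: "a \<le> b" and abJ: "{a..b} \<subseteq> J"
    and P: "herglotz_field a b P"
    and LK: "\<And>t z. t \<in> {a..b} \<Longrightarrow> z \<in> ball 0 1 \<Longrightarrow> F' t z = z * deriv (F t) z * P t z"
    and norm: "\<And>t. t \<in> J \<Longrightarrow> deriv (F t) 0 \<in> \<real> \<and> Re (deriv (F t) 0) > 0"
  shows "subordinate (F a) (F b)"
proof -
  interpret P: herglotz_field a b P by fact
  have in_ab: "a \<in> {a..b}" "b \<in> {a..b}" using ab by auto
  have const: "F b (P.flow b z) = F a z" if z: "z \<in> ball 0 1" for z
  proof -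
    have "((\<lambda>t. F t (P.flow t z)) has_vector_derivative 0) (at t within {a..b})" if t: "t \<in> {a..b}" for t
    proof -
      have "((\<lambda>t. F t (P.flow t z)) has_vector_derivative
          F' t (P.flow t z) + deriv (F t) (P.flow t z) * (- P.flow t z * P t (P.flow t z))) (at t within {a..b})"
        by (rule has_vector_derivative_curve[OF abJ t _ P.flow_ode[OF t z]]) (use P.flow_in_ball z U in auto)
      thus ?thesis using LK[OF t P.flow_in_ball[OF t z]] by (simp add: mult_ac)
    qed
    hence "((\<lambda>t. F t (P.flow t z)) has_derivative (\<lambda>h. 0)) (at t within {a..b})" if "t \<in> {a..b}" for t
      using that by (simp add: has_vector_derivative_def)
    hence "\<exists>c. \<forall>t\<in>{a..b}. F t (P.flow t z) = c"
      by (intro has_derivative_zero_constant) auto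
    thus ?thesis using in_ab P.flow_start[OF ab z] by metis
  qed
  have hol: "P.flow b holomorphic_on ball 0 1" by (rule P.holomorphic_on_flow[OF in_ab(2)])
  have f0: "P.flow b 0 = 0" using P.norm_flow_le[OF in_ab(2), of 0] by simp
  \<comment> \<open>The chain rule at 0 exhibits the derivative of the flow as a quotient of two
    positive first coefficients, which is the normalisation required of a subordinating map.\<close>
  have "(P.flow b has_field_derivative deriv (P.flow b) 0) (at 0)"
    by (rule holomorphic_derivI[OF hol]) auto
  moreover have "(F b has_field_derivative deriv (F b) 0) (at (P.flow b 0))"
    unfolding f0 using abJ in_ab U by (intro holomorphic_derivI[OF holomorphic open_U]) auto
  ultimately have "((\<lambda>z. F b (P.flow b z)) has_field_derivative deriv (F b) 0 * deriv (P.flow b) 0) (at 0)"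
    using DERIV_chain2 by blast
  hence "(F a has_field_derivative deriv (F b) 0 * deriv (P.flow b) 0) (at 0)"
    by (rule has_field_derivative_transform_within_open[of _ _ _ "ball 0 1"]) (auto simp: const)
  hence eq: "deriv (F a) 0 = deriv (F b) 0 * deriv (P.flow b) 0" by (rule DERIV_imp_deriv)
  have nb: "deriv (F b) 0 \<in> \<real>" "Re (deriv (F b) 0) > 0" and na: "deriv (F a) 0 \<in> \<real>" "Re (deriv (F a) 0) > 0"
    using norm abJ in_ab by blast+
  obtain \<alpha> \<beta> where \<alpha>\<beta>: "deriv (F a) 0 = of_real \<alpha>" "deriv (F b) 0 = of_real \<beta>" "\<alpha> > 0" "\<beta> > 0"
    using na nb by (auto elim!: Reals_cases)
  hence "deriv (P.flow b) 0 = of_real (\<alpha> / \<beta>)" using eq by (simp add: field_simps)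
  thus ?thesis
    unfolding subordinate_def using hol f0 P.inj_on_flow[OF ab] P.flow_in_ball[OF in_ab(2)] const \<alpha>\<beta>
    by (intro exI[of _ "P.flow b"]) auto
qed

subsection \<open>Smooth families on the closed disc\<close>

locale smooth_disc_family =
  fixes I :: "real set" and f :: "real \<Rightarrow> complex \<Rightarrow> complex"
  assumes interval: "is_interval I" and nontrivial: "interior I \<noteq> {}"
    and O_norm: "\<And>t. t \<in> I \<Longrightarrow> f t \<in> O_norm (cball 0 1)"
    and smooth: "smooth_family I f"
    and regular: "\<And>t \<zeta>. t \<in> I \<Longrightarrow> \<zeta> \<in> sphere 0 1 \<Longrightarrow> deriv (f t) \<zeta> \<noteq> 0"
begin

lemma convex_I: "convex I"
  using interval by (simp add: is_interval_convex)

lemma islimpt_I: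
  assumes "t \<in> I"
  shows "t islimpt I"
  by (rule connected_imp_perfect[OF convex_connected[OF convex_I] assms]) (use nontrivial in auto)



lemma local_C1_family:
  assumes t0: "t0 \<in> I"
  obtains e U where "e > 0" "cball 0 1 \<subseteq> U" "C1_family (I \<inter> ball t0 e) U f (time_deriv I f)"
proof -
  obtain e U where eU: "e > 0" "open U" "cball 0 1 \<subseteq> U" "\<forall>t\<in>I \<inter> ball t0 e. f t holomorphic_on U"
    and k: "\<forall>k. (\<forall>t\<in>I \<inter> ball t0 e. \<forall>\<zeta>\<in>U. (\<lambda>s. (time_deriv I ^^ k) f s \<zeta>) differentiable (at t within I)) \<and>
            continuous_on ((I \<inter> ball t0 e) \<times> U) (\<lambda>(t, \<zeta>). (time_deriv I ^^ k) f t \<zeta>)"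
    using smooth t0 unfolding smooth_family_def by metis
  have "C1_family (I \<inter> ball t0 e) U f (time_deriv I f)"
  proof
    show "convex (I \<inter> ball t0 e)" by (intro convex_Int convex_I convex_ball)
    show "t islimpt I \<inter> ball t0 e" if "t \<in> I \<inter> ball t0 e" for t
      using that islimpt_I eventually_at_in_open'[OF open_ball, of t t0 e] by (intro islimpt_Int_eventually) auto
    show "continuous_on ((I \<inter> ball t0 e) \<times> U) (\<lambda>(t, z). f t z)"
      using spec[OF k, of 0] by simp
    show "continuous_on ((I \<inter> ball t0 e) \<times> U) (\<lambda>(t, z). time_deriv I f t z)"
      using spec[OF k, of 1] by simp
    show "((\<lambda>s. f s z) has_vector_derivative time_deriv I f t z) (at t within I \<inter> ball t0 e)"
      if "t \<in> I \<inter> ball t0 e" "z \<in> U" for t z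
    proof -
      have "(\<lambda>s. f s z) differentiable (at t within I)" using spec[OF k, of 0] that by auto
      hence "((\<lambda>s. f s z) has_vector_derivative time_deriv I f t z) (at t within I)"
        by (simp add: vector_derivative_works time_deriv_def)
      thus ?thesis by (rule has_vector_derivative_within_subset) auto
    qed
  qed (use eU in auto)
  thus ?thesis using that eU by blast
qed

lemma time_derivative:
  assumes "t \<in> I" "z \<in> cball 0 1"
  shows "((\<lambda>s. f s z) has_vector_derivative time_deriv I f t z) (at t within I)"
proof -
  obtain e U where eU: "e > 0" "cball 0 1 \<subseteq> U" "C1_family (I \<inter> ball t e) U f (time_deriv I f)"
    using local_C1_family[OF assms(1)] by blast
  have "((\<lambda>s. f s z) has_vector_derivative time_deriv I f t z) (at t within I \<inter> ball t e)"
    using eU(1,2) assms by (intro C1_family.vector_derivative[OF eU(3)]) auto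
  moreover have "at t within I \<inter> ball t e = at t within I"
    using eU(1) by (intro at_within_nhd[of t "ball t e"]) auto
  ultimately show ?thesis by simp
qed

text \<open>The neighbourhood of the closed disc varies with \<open>t0\<close>; the closed disc is
  common to all times, so local joint continuity can be patched there.\<close>

lemma continuous_on_I_times:
  fixes g :: "real \<Rightarrow> complex \<Rightarrow> complex"
  assumes "\<And>t0 e U. t0 \<in> I \<Longrightarrow> C1_family (I \<inter> ball t0 e) U f (time_deriv I f) \<Longrightarrow>
      continuous_on ((I \<inter> ball t0 e) \<times> U) (\<lambda>(t, z). g t z)"
  shows "continuous_on (I \<times> cball 0 1) (\<lambda>(t, z). g t z)"
proof (rule continuous_on_locally, clarify)
  fix t0 :: real and z :: complex assume "t0 \<in> I"
  then obtain e U where eU: "e > 0" "cball 0 1 \<subseteq> U" "C1_family (I \<inter> ball t0 e) U f (time_deriv I f)"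
    using local_C1_family by blast
  have "continuous_on (I \<times> cball 0 1 \<inter> (ball t0 e \<times> UNIV)) (\<lambda>(t, z). g t z)"
    by (rule continuous_on_subset[OF assms[OF \<open>t0 \<in> I\<close> eU(3)]]) (use eU in auto)
  thus "\<exists>T. open T \<and> (t0, z) \<in> T \<and> continuous_on (I \<times> cball 0 1 \<inter> T) (\<lambda>(t, z). g t z)"
    using eU(1) by (intro exI[of _ "ball t0 e \<times> UNIV"]) (auto intro!: open_Times)
qed

lemma continuous_time_derivative: "continuous_on (I \<times> cball 0 1) (\<lambda>(t, z). time_deriv I f t z)"
  by (rule continuous_on_I_times) (rule C1_family.continuous')

lemma continuous_deriv: "continuous_on (I \<times> cball 0 1) (\<lambda>(t, z). deriv (f t) z)"
  by (rule continuous_on_I_times) (rule C1_family.continuous[OF C1_family.C1_family_deriv])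

lemma holomorphic_extension:
  assumes "t \<in> I"
  obtains U where "open U" "cball 0 1 \<subseteq> U" "f t holomorphic_on U" "time_deriv I f t holomorphic_on U"
proof -
  obtain e U where eU: "e > 0" "cball 0 1 \<subseteq> U" "C1_family (I \<inter> ball t e) U f (time_deriv I f)"
    using local_C1_family[OF assms] by blast
  thus ?thesis using that[of U] assms C1_family.open_U[OF eU(3)] C1_family.holomorphic[OF eU(3), of t]
      C1_family.holomorphic'[OF eU(3), of t] by simp
qed

lemma deriv_0:
  assumes "t \<in> I"
  shows "f t 0 = 0" "deriv (f t) 0 \<in> \<real>" "Re (deriv (f t) 0) > 0"
  using O_norm[OF assms] by (auto simp: O_norm_def)

text \<open>The open disc serves all times at once, and \<open>f'\<close> is nonzero at 0. Questions
  on the boundary are settled by a holomorphic extension at one time.\<close>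

sublocale nonconstant_C1_family I "ball 0 1" f "time_deriv I f"
proof
  show "f t holomorphic_on ball 0 1" if "t \<in> I" for t
    using holomorphic_extension[OF that] by (metis ball_subset_cball holomorphic_on_subset)
  have "continuous_on (I \<times> cball 0 1) (\<lambda>(t, z). f t z)"
    by (rule continuous_on_I_times) (rule C1_family.continuous)
  thus "continuous_on (I \<times> ball 0 1) (\<lambda>(t, z). f t z)"
    by (rule continuous_on_subset) auto
  show "continuous_on (I \<times> ball 0 1) (\<lambda>(t, z). time_deriv I f t z)"
    by (rule continuous_on_subset[OF continuous_time_derivative]) auto
  show "\<exists>\<beta>\<in>ball 0 1. deriv (f t) \<beta> \<noteq> 0" if "t \<in> I" for t
    using deriv_0[OF that] by (intro bexI[of _ 0]) auto
qed (use convex_I islimpt_I time_derivative in auto)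

lemma continuous_on_boundary_density:
  assumes "t \<in> I"
  shows "continuous_on (sphere 0 1) (\<lambda>u. c / (cmod (deriv (f t) u))\<^sup>2)"
proof -
  have "continuous_on (sphere 0 1) (deriv (f t))"
    by (rule continuous_on_subset[OF continuous_on_section[OF continuous_deriv assms]]) auto
  thus ?thesis using regular[OF assms] by (intro continuous_intros) auto
qed

lemma LK_P_eq:
  assumes "t \<in> I" "cmod w < 1"
  shows "LK_P q f t w = schwarz (\<lambda>u. q t / (cmod (deriv (f t) u))\<^sup>2) w"
proof -
  have "continuous_on (sphere 0 1) (deriv (f t))"
    by (rule continuous_on_subset[OF continuous_on_section[OF continuous_deriv assms(1)]]) auto
  thus ?thesis by (intro LK_P_eq_schwarz regular assms)
qed

section \<open>Passing between the three conditions\<close>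

lemma Re_mult_cnj: "Re (x * p * cnj x) = (cmod x)\<^sup>2 * Re p"
  by (simp add: cmod_power2) (simp add: power2_eq_square algebra_simps)

text \<open>Inside the disc the equation gives Re of the product as |\<zeta>
  f'|\<open>\<^sup>2\<close> Re P. The factors other than P are continuous across the circle by
  analytic extension, so a radial limit suffices.\<close>

lemma Loewner_Kufarev_imp_Polubarinova_Galin:
  assumes LK: "Loewner_Kufarev I q f"
  shows "Polubarinova_Galin I q f"
  unfolding Polubarinova_Galin_def
proof clarify
  fix t and \<zeta> :: complex assume t: "t \<in> I" and \<zeta>: "\<zeta> \<in> sphere 0 1"
  have z1: "cmod \<zeta> = 1" using \<zeta> by simp
  define Q where "Q = (\<lambda>u. q t / (cmod (deriv (f t) u))\<^sup>2)"
  have cQ: "continuous_on (sphere 0 1) Q"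
    unfolding Q_def by (rule continuous_on_boundary_density[OF t])
  obtain U where U: "open U" "cball 0 1 \<subseteq> U" "f t holomorphic_on U" "time_deriv I f t holomorphic_on U"
    using holomorphic_extension[OF t] by blast
  have \<zeta>U: "\<zeta> \<in> U" using U(2) z1 by auto
  have c: "isCont (time_deriv I f t) \<zeta>" "isCont (deriv (f t)) \<zeta>"
    using holomorphic_on_imp_continuous_on[OF U(4)] holomorphic_on_imp_continuous_on[OF holomorphic_deriv[OF U(3,1)]]
      \<zeta>U U(1) by (auto simp: continuous_on_eq_continuous_at)
  have lim: "((\<lambda>r. of_real r * \<zeta>) \<longlongrightarrow> \<zeta>) (at_left (1::real))"
    by (auto intro!: tendsto_eq_intros)
  have l1: "((\<lambda>r. time_deriv I f t (of_real r * \<zeta>)) \<longlongrightarrow> time_deriv I f t \<zeta>) (at_left 1)"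
    by (rule isCont_tendsto_compose[OF c(1) lim])
  have l2: "((\<lambda>r. deriv (f t) (of_real r * \<zeta>)) \<longlongrightarrow> deriv (f t) \<zeta>) (at_left 1)"
    by (rule isCont_tendsto_compose[OF c(2) lim])
  let ?L = "\<lambda>r. Re (time_deriv I f t (of_real r * \<zeta>) * cnj (of_real r * \<zeta> * deriv (f t) (of_real r * \<zeta>)))"
  let ?R = "\<lambda>r. (cmod (of_real r * \<zeta> * deriv (f t) (of_real r * \<zeta>)))\<^sup>2 * Re (schwarz Q (of_real r * \<zeta>))"
  have L: "(?L \<longlongrightarrow> Re (time_deriv I f t \<zeta> * cnj (\<zeta> * deriv (f t) \<zeta>))) (at_left 1)"
    by (intro tendsto_intros l1 l2 lim)
  have R: "(?R \<longlongrightarrow> (cmod (\<zeta> * deriv (f t) \<zeta>))\<^sup>2 * Q \<zeta>) (at_left 1)"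
    by (intro tendsto_intros l2 lim Re_schwarz_radial_limit cQ z1)
  have "\<forall>\<^sub>F r in at_left (1::real). 0 < r \<and> r < 1"
    by (auto simp: eventually_at_left_field intro!: exI[of _ 0])
  hence "\<forall>\<^sub>F r in at_left (1::real). ?L r = ?R r"
  proof eventually_elim
    case (elim r)
    define w where "w = of_real r * \<zeta>"
    have w: "cmod w < 1" using elim z1 by (simp add: w_def norm_mult)
    have "time_deriv I f t w = (w * deriv (f t) w) * schwarz Q w"
      using LK t w unfolding Loewner_Kufarev_def by (simp add: LK_P_eq Q_def)
    thus ?case unfolding w_def[symmetric] by (simp only: Re_mult_cnj)
  qed
  hence "(?L \<longlongrightarrow> (cmod (\<zeta> * deriv (f t) \<zeta>))\<^sup>2 * Q \<zeta>) (at_left 1)"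
    using R by (simp only: tendsto_cong)
  hence "Re (time_deriv I f t \<zeta> * cnj (\<zeta> * deriv (f t) \<zeta>)) = (cmod (\<zeta> * deriv (f t) \<zeta>))\<^sup>2 * Q \<zeta>"
    by (intro tendsto_unique[OF trivial_limit_at_left_real L])
  also have "\<dots> = q t" using regular[OF t \<zeta>] z1 by (simp add: Q_def norm_mult)
  finally show "Re (time_deriv I f t \<zeta> * cnj (\<zeta> * deriv (f t) \<zeta>)) = q t" .
qed

text \<open>The normalisation differentiated in time. The first part permits division by \<zeta>,
  the second makes the value of the quotient at 0 real.\<close>

lemma time_derivative_0:
  assumes t: "t \<in> I"
  shows "time_deriv I f t 0 = 0" "Im (deriv (time_deriv I f t) 0) = 0"
proof -
  show "time_deriv I f t 0 = 0"
  proof (rule vector_derivative_unique[OF t])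
    show "((\<lambda>s. f s 0) has_vector_derivative time_deriv I f t 0) (at t within I)"
      by (rule time_derivative[OF t]) simp
    show "((\<lambda>s. f s 0) has_vector_derivative 0) (at t within I)"
      by (rule has_vector_derivative_transform[OF t _ has_vector_derivative_const[of 0]]) (simp add: deriv_0)
  qed
  have "((\<lambda>s. deriv (f s) 0) has_vector_derivative deriv (time_deriv I f t) 0) (at t within I)"
    by (rule C1_family.vector_derivative[OF C1_family_deriv t]) simp
  hence "((\<lambda>s. Im (deriv (f s) 0)) has_vector_derivative Im (deriv (time_deriv I f t) 0)) (at t within I)"
    by (rule bounded_linear.has_vector_derivative[OF bounded_linear_Im])
  moreover have "((\<lambda>s. Im (deriv (f s) 0)) has_vector_derivative 0) (at t within I)"
    by (rule has_vector_derivative_transform[OF t _ has_vector_derivative_const[of 0]])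
      (use deriv_0(2) complex_is_Real_iff in simp)
  ultimately show "Im (deriv (time_deriv I f t) 0) = 0"
    by (rule vector_derivative_unique[OF t])
qed

lemma Polubarinova_Galin_imp_Loewner_Kufarev:
  assumes PG: "Polubarinova_Galin I q f"
    and div: "\<And>t w. t \<in> I \<Longrightarrow> w \<in> ball 0 1 \<Longrightarrow> divides_at (deriv (f t)) (time_deriv I f t) w"
  shows "Loewner_Kufarev I q f"
  unfolding Loewner_Kufarev_def
proof clarify
  fix t and w :: complex assume t: "t \<in> I" and w: "w \<in> ball 0 1"
  let ?g = "time_deriv I f t" and ?f' = "deriv (f t)"
  obtain U where U: "open U" "cball 0 1 \<subseteq> U" "f t holomorphic_on U" "?g holomorphic_on U"
    using holomorphic_extension[OF t] by blast
  have hf': "?f' holomorphic_on U" by (rule holomorphic_deriv[OF U(3,1)])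
  define W where "W = U \<inter> ?f' -` (- {0})"
  have oW: "open W" unfolding W_def
    using U(1) holomorphic_on_imp_continuous_on[OF hf'] by (intro continuous_open_preimage) auto
  \<comment> \<open>Divisibility is given only in the open disc. Adding the points with nonzero
    derivative yields an open set around the closed disc, so the quotient is continuous up to the
    circle, as the Schwarz formula requires.\<close>
  define V where "V = ball 0 1 \<union> W"
  have oV: "open V" using oW by (simp add: V_def open_Un)
  have sub: "cball 0 1 \<subseteq> V"
  proof
    fix z :: complex assume z: "z \<in> cball 0 1"
    show "z \<in> V"
    proof (cases "cmod z = 1")
      case True
      thus ?thesis using regular[OF t, of z] U(2) by (auto simp: V_def W_def)
    qed (use z in \<open>auto simp: V_def\<close>)
  qed
  have "divides_at ?f' ?g z" if "z \<in> V" for z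
    using that div[OF t] divides_at_nonzero[OF U(4) hf' U(1)] by (auto simp: V_def W_def)
  moreover have "\<forall>\<^sub>F u in at z. ?f' u \<noteq> 0" if "z \<in> V" for z
    using that
  proof (unfold V_def, elim UnE)
    assume "z \<in> W"
    from eventually_at_in_open'[OF oW this] show ?thesis
      by eventually_elim (simp add: W_def)
  qed (rule deriv_eventually_nonzero[OF t])
  ultimately obtain p1 where p1: "p1 holomorphic_on V" "\<And>z. z \<in> V \<Longrightarrow> ?g z = ?f' z * p1 z"
    using divides_at_imp_quotient[OF oV] by metis
  have V0: "0 \<in> V" using sub by auto
  have f0: "?f' 0 \<noteq> 0" using deriv_0[OF t] by auto
  have p10: "p1 0 = 0" using p1(2)[OF V0] f0 time_derivative_0(1)[OF t] by simp
  define p where "p = (\<lambda>z. if z = 0 then deriv p1 0 else p1 z / z)"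
  have hp: "p holomorphic_on V"
    by (rule pole_theorem_open_0[OF p1(1) oV, of 0]) (auto simp: p_def p10)
  have gp: "?g z = z * ?f' z * p z" if "z \<in> V" for z
    using p1(2)[OF that] p10 by (auto simp: p_def)
  \<comment> \<open>The value \<open>p 0\<close> is the quotient of the derivatives at 0 of
    \<open>?g\<close> and \<open>f t\<close>, both real; this removes the constant from the Schwarz
    formula.\<close>
  have Im_p0: "Im (p 0) = 0"
  proof -
    have "((\<lambda>z. ?f' z * p1 z) has_field_derivative deriv ?f' 0 * p1 0 + deriv p1 0 * ?f' 0) (at 0)"
      using U(2) by (intro DERIV_mult holomorphic_derivI[OF hf' U(1)] holomorphic_derivI[OF p1(1) oV V0]) auto
    hence "((\<lambda>z. ?f' z * p1 z) has_field_derivative deriv p1 0 * ?f' 0) (at 0)"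
      by (simp add: p10)
    hence "(?g has_field_derivative deriv p1 0 * ?f' 0) (at 0)"
      by (rule has_field_derivative_transform_within_open[OF _ oV V0]) (simp add: p1(2))
    hence eq: "deriv ?g 0 = deriv p1 0 * ?f' 0" by (rule DERIV_imp_deriv)
    obtain c where c: "?f' 0 = of_real c" "c > 0"
      using deriv_0(2,3)[OF t] by (auto elim!: Reals_cases)
    have "Im (deriv p1 0) * c = 0"
      using time_derivative_0(2)[OF t] unfolding eq c(1) by simp
    thus ?thesis using c(2) by (simp add: p_def)
  qed
  have cp: "continuous_on (cball 0 1) p" "p holomorphic_on ball 0 1"
    using hp sub ball_subset_cball holomorphic_on_imp_continuous_on holomorphic_on_subset by blast+
  have "schwarz (\<lambda>u. q t / (cmod (?f' u))\<^sup>2) w = circle_mean 0 1 (\<lambda>u. of_real (Re (p u)) * herglotz w u)"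
    unfolding schwarz_def
  proof (intro circle_mean_cong)
    fix u :: complex assume u: "u \<in> sphere 0 1"
    have "u \<in> V" using u sub by auto
    have "q t = Re (?g u * cnj (u * ?f' u))"
      using PG t u unfolding Polubarinova_Galin_def by metis
    also have "\<dots> = Re ((u * ?f' u) * p u * cnj (u * ?f' u))"
      by (simp only: gp[OF \<open>u \<in> V\<close>])
    also have "\<dots> = (cmod (u * ?f' u))\<^sup>2 * Re (p u)" by (rule Re_mult_cnj)
    also have "cmod (u * ?f' u) = cmod (?f' u)" using u by (simp add: norm_mult)
    finally have "q t / (cmod (?f' u))\<^sup>2 = Re (p u)" using regular[OF t u] by simp
    thus "of_real (q t / (cmod (?f' u))\<^sup>2) * herglotz w u = of_real (Re (p u)) * herglotz w u" by simp
  qed simp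
  also have "\<dots> = p w"
    using Schwarz_integral_formula[OF cp, of w] w Im_p0 by simp
  finally have "LK_P q f t w = p w" using LK_P_eq[OF t] w by simp
  moreover have "w \<in> V" using w by (simp add: V_def)
  ultimately show "?g w = w * ?f' w * LK_P q f t w" using gp by simp
qed

lemma Loewner_Kufarev_imp_subordination_chain:
  assumes LK: "Loewner_Kufarev I q f" and q: "\<And>t. t \<in> I \<Longrightarrow> q t \<ge> 0"
  shows "subordination_chain I f"
proof -
  have PG: "Polubarinova_Galin I q f" by (rule Loewner_Kufarev_imp_Polubarinova_Galin[OF LK])
  \<comment> \<open>Continuity of \<open>q\<close> is read off the boundary equation at \<zeta> = 1;
    joint continuity of the Herglotz field depends on it.\<close>
  have "continuous_on I (\<lambda>t. Re (time_deriv I f t 1 * cnj (1 * deriv (f t) 1)))"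
    by (intro continuous_intros continuous_on_compose2[OF continuous_time_derivative, where f = "\<lambda>t. (t, 1)", simplified split_beta fst_conv snd_conv]
        continuous_on_compose2[OF continuous_deriv, where f = "\<lambda>t. (t, 1)", simplified split_beta fst_conv snd_conv]) auto
  moreover have "(1::complex) \<in> sphere 0 1" by simp
  hence "Re (time_deriv I f t 1 * cnj (1 * deriv (f t) 1)) = q t" if "t \<in> I" for t
    using PG that unfolding Polubarinova_Galin_def by blast
  ultimately have cq: "continuous_on I q" by (rule continuous_on_eq)
  let ?P = "\<lambda>t. schwarz (\<lambda>u. q t / (cmod (deriv (f t) u))\<^sup>2)"
  have field: "herglotz_field s t ?P" if "s \<in> I" "t \<in> I" for s t
  proof
    have sub: "{s..t} \<subseteq> I"
      using mem_is_interval_1_I[OF interval that] by auto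
    have "continuous_on (I \<times> sphere 0 1) (\<lambda>(t, z). deriv (f t) z)"
      by (rule continuous_on_subset[OF continuous_deriv]) auto
    hence c1: "continuous_on ({s..t} \<times> sphere 0 1) (\<lambda>p. deriv (f (fst p)) (snd p))"
      unfolding case_prod_unfold by (rule continuous_on_subset) (use sub in auto)
    have c2: "continuous_on ({s..t} \<times> sphere 0 1) (\<lambda>p. q (fst p))"
      by (rule continuous_on_compose2[OF cq]) (use sub in \<open>auto intro!: continuous_intros\<close>)
    have "continuous_on ({s..t} \<times> sphere 0 1) (\<lambda>(\<tau>, u). q \<tau> / (cmod (deriv (f \<tau>) u))\<^sup>2)"
      unfolding case_prod_unfold using regular sub by (intro continuous_intros c1 c2) auto
    thus "continuous_on ({s..t} \<times> ball 0 1) (\<lambda>(\<tau>, z). ?P \<tau> z)"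
      by (rule continuous_on_schwarz)
    show "?P \<tau> holomorphic_on ball 0 1" if "\<tau> \<in> {s..t}" for \<tau>
      using that sub by (intro holomorphic_schwarz continuous_on_boundary_density) auto
    show "Re (?P \<tau> z) \<ge> 0" if "\<tau> \<in> {s..t}" "z \<in> ball 0 1" for \<tau> z
      using that sub q by (intro Re_schwarz_nonneg continuous_on_boundary_density) auto
  qed
  have "subordinate (f s) (f t)" if st: "s \<in> I" "t \<in> I" "s \<le> t" for s t
  proof (rule Loewner_Kufarev_imp_subordinate[OF refl st(3) _ field[OF st(1,2)]])
    show sub: "{s..t} \<subseteq> I"
      using mem_is_interval_1_I[OF interval st(1,2)] by auto
    show "time_deriv I f \<tau> z = z * deriv (f \<tau>) z * ?P \<tau> z" if "\<tau> \<in> {s..t}" "z \<in> ball 0 1" for \<tau> z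
      using LK that sub LK_P_eq[of \<tau> z q] unfolding Loewner_Kufarev_def by auto
  qed (use deriv_0 in blast)
  moreover have "f t \<in> O_norm (ball 0 1)" if "t \<in> I" for t
    using O_norm[OF that] ball_subset_cball unfolding O_norm_def by (auto elim: analytic_on_subset)
  ultimately show ?thesis unfolding subordination_chain_def by blast
qed

end

theorem theorem3p1:
  fixes I :: "real set"
    and f :: "real \<Rightarrow> complex \<Rightarrow> complex"
    and q :: "real \<Rightarrow> real"
  assumes "is_interval I" and "interior I \<noteq> {}" and "I \<subseteq> {0..}"
    and "\<And>t. t \<in> I \<Longrightarrow> f t \<in> O_norm (cball 0 1)"
    and "smooth_family I f"
    and "\<And>t \<zeta>. t \<in> I \<Longrightarrow> \<zeta> \<in> sphere 0 1 \<Longrightarrow> deriv (f t) \<zeta> \<noteq> 0"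
    and "\<And>t. t \<in> I \<Longrightarrow> q t \<ge> 0"
  shows "(Loewner_Kufarev I q f \<longleftrightarrow>
            Polubarinova_Galin I q f \<and>
            (\<forall>t\<in>I. \<forall>\<omega>\<in>ball 0 1. deriv (f t) \<omega> = 0 \<longrightarrow> time_deriv I f t \<omega> = 0)) \<and>
         (Loewner_Kufarev I q f \<longleftrightarrow>
            Polubarinova_Galin I q f \<and> subordination_chain I f)"
proof -
  interpret smooth_disc_family I f
    using assms by unfold_locales auto
  let ?stat = "\<forall>t\<in>I. \<forall>\<omega>\<in>ball 0 1. deriv (f t) \<omega> = 0 \<longrightarrow> time_deriv I f t \<omega> = 0"
  have i_ii: "Polubarinova_Galin I q f \<and> ?stat" if "Loewner_Kufarev I q f"
    using that Loewner_Kufarev_imp_Polubarinova_Galin[OF that] unfolding Loewner_Kufarev_def by auto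
  have ii_i: "Loewner_Kufarev I q f" if "Polubarinova_Galin I q f" ?stat
    using that(2) by (intro Polubarinova_Galin_imp_Loewner_Kufarev[OF that(1)] critical_points_stationary_imp_divides_at) auto
  have iii_ii: ?stat if "subordination_chain I f"
  proof (intro ballI impI)
    fix t \<omega> assume "t \<in> I" "\<omega> \<in> ball 0 1" "deriv (f t) \<omega> = 0"
    thus "time_deriv I f t \<omega> = 0"
      using that deriv_0 unfolding subordination_chain_def
      by (intro subordination_imp_critical_points_stationary) auto
  qed
  have i_iii: "subordination_chain I f" if "Loewner_Kufarev I q f"
    using Loewner_Kufarev_imp_subordination_chain[OF that] assms(7) by blast
  show ?thesis using i_ii ii_i iii_ii i_iii by blast
qed

end
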